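(* Let $G$ and $H$ be connected graphs on $n$ vertices. If $G\geq_s H$ then $\alpha(G)\geq \alpha(H)$.
   Context: All graphs are finite and simple. $\alpha(G)$ is the independence number of $G$ (the maximum size of a set of pairwise non-adjacent vertices). The chromatic symmetric function of a graph $G$ with vertices $v_1,\dots,v_n$ is $X_G=\sum_{\kappa}x_{\kappa(v_1)}\cdots x_{\kappa(v_n)}$, summed over all proper colorings $\kappa:V(G)\to\{1,2,3,\dots\}$; it is a homogeneous symmetric function of degree $n$ over $\mathbb{Q}$. Let $s_\lambda$ be the Schur symmetric functions; $[s_\lambda]F$ denotes the coefficient of $s_\lambda$ in $F$ expanded in this basis, and $F$ is Schur-positive if $[s_\lambda]F\ge 0$ for all $\lambda$. For connected graphs $G,H$ on $n$ vertices (for which $[s_{(1^n)}]X_G$ and $[s_{(1^n)}]X_H$ are positive), set $$X_s(G,H)=X_G-\frac{[s_{(1^n)}]X_G}{[s_{(1^n)}]X_H}X_H,$$ and write $G\geq_s H$ if $X_s(G,H)$ is Schur-positive. *)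

theory Defs
  imports
    Complex_Main
    "HOL-Library.FuncSet"
    "HOL-Library.Function_Algebras"
    "HOL-Library.Poly_Mapping"
    "Graph_Theory.Digraph_Component"
    "Graph_Theory.Pair_Digraph"
begin

section \<open>Formal power series in countably many variables\<close>

text \<open>
  The monomial \<open>x\<^sub>1 ^ m\<^sub>1 * x\<^sub>2 ^ m\<^sub>2 * \<dots>\<close> is represented by its finitely supported exponent vector
  \<open>m\<close>, and a formal power series over the rationals by its coefficient function.  The variables
  are indexed by the positive natural numbers; the index 0 is never used.  Only the (pointwise)
  vector space structure is needed; note that the pointwise product of the underlying function
  type is not the product of power series.
\<close>

type_synonym monomial = "nat \<Rightarrow>\<^sub>0 nat"
type_synonym power_series = "monomial \<Rightarrow> rat"

definition ps_scale :: "rat \<Rightarrow> power_series \<Rightarrow> power_series" where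
  "ps_scale c F = (\<lambda>m. c * F m)"

interpretation ps: vector_space ps_scale
  by unfold_locales (auto simp: ps_scale_def fun_eq_iff algebra_simps)

text \<open>
  The product of the variables \<open>x\<^bsub>f a\<^esub>\<close> over all \<open>a \<in> A\<close>: addition of exponent vectors is
  multiplication of monomials.
\<close>

definition monomial_of :: "('a \<Rightarrow> nat) \<Rightarrow> 'a set \<Rightarrow> monomial" where
  "monomial_of f A = (\<Sum>a\<in>A. Poly_Mapping.single (f a) 1)"


section \<open>Schur functions\<close>

definition is_partition :: "nat list \<Rightarrow> bool" where
  "is_partition l \<longleftrightarrow> sorted_wrt (\<ge>) l \<and> (\<forall>p\<in>set l. 0 < p)"

definition young_diagram :: "nat list \<Rightarrow> (nat \<times> nat) set" where
  "young_diagram l = {(i, j). i < length l \<and> j < l ! i}"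

definition ssyt :: "nat list \<Rightarrow> (nat \<times> nat \<Rightarrow> nat) set" where
  "ssyt l = {T \<in> young_diagram l \<rightarrow>\<^sub>E {1..}.
     (\<forall>i j. (i, Suc j) \<in> young_diagram l \<longrightarrow> T (i, j) \<le> T (i, Suc j)) \<and>
     (\<forall>i j. (Suc i, j) \<in> young_diagram l \<longrightarrow> T (i, j) < T (Suc i, j))}"

definition schur :: "nat list \<Rightarrow> power_series" where
  "schur l = (\<lambda>m. of_nat (card {T \<in> ssyt l. monomial_of T (young_diagram l) = m}))"

text \<open>
  The coefficient of the Schur function of \<open>l\<close> in the expansion of \<open>F\<close> in the basis of all Schur
  functions.  It is only meaningful if \<open>l\<close> is a partition and \<open>F\<close> is a symmetric function, that is,
  in the span of the Schur functions.
\<close>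

definition schur_coeff :: "nat list \<Rightarrow> power_series \<Rightarrow> rat" where
  "schur_coeff l F = ps.representation (schur ` {l. is_partition l}) F (schur l)"

definition schur_positive :: "power_series \<Rightarrow> bool" where
  "schur_positive F \<longleftrightarrow> (\<forall>l. is_partition l \<longrightarrow> 0 \<le> schur_coeff l F)"


section \<open>Graphs\<close>

text \<open>
  A finite simple graph is a \<^locale>\<open>pair_graph\<close>: an edge between \<open>u\<close> and \<open>v\<close> is represented by the two
  arcs \<open>(u, v)\<close> and \<open>(v, u)\<close>.
\<close>

definition independent_set :: "'a pair_pre_digraph \<Rightarrow> 'a set \<Rightarrow> bool" where
  "independent_set G S \<longleftrightarrow> S \<subseteq> pverts G \<and> (\<forall>u\<in>S. \<forall>v\<in>S. (u, v) \<notin> parcs G)"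

definition independence_number :: "'a pair_pre_digraph \<Rightarrow> nat" where
  "independence_number G = Max (card ` {S. independent_set G S})"

definition proper_colorings :: "'a pair_pre_digraph \<Rightarrow> ('a \<Rightarrow> nat) set" where
  "proper_colorings G = {\<kappa> \<in> pverts G \<rightarrow>\<^sub>E {1..}. \<forall>(u, v)\<in>parcs G. \<kappa> u \<noteq> \<kappa> v}"

text \<open>
  Only finitely many proper colorings yield a given monomial, so the coefficient of a monomial is
  a finite cardinality.
\<close>

definition chromatic_sym :: "'a pair_pre_digraph \<Rightarrow> power_series" where
  "chromatic_sym G =
     (\<lambda>m. of_nat (card {\<kappa> \<in> proper_colorings G. monomial_of \<kappa> (pverts G) = m}))"

text \<open>
  Intended for connected graphs \<open>G\<close> and \<open>H\<close> with the same number \<open>n\<close> of vertices; the list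
  \<open>replicate n 1\<close> is the partition of \<open>n\<close> into ones.
\<close>

definition schur_diff :: "'a pair_pre_digraph \<Rightarrow> 'b pair_pre_digraph \<Rightarrow> power_series" where
  "schur_diff G H =
     (let n = card (pverts G) in
      chromatic_sym G -
      ps_scale (schur_coeff (replicate n 1) (chromatic_sym G) /
                schur_coeff (replicate n 1) (chromatic_sym H))
        (chromatic_sym H))"

definition schur_ge :: "'a pair_pre_digraph \<Rightarrow> 'b pair_pre_digraph \<Rightarrow> bool"
    (infix \<open>\<ge>\<^sub>s\<close> 50) where
  "G \<ge>\<^sub>s H \<longleftrightarrow> schur_positive (schur_diff G H)"

end

theory Submission
  imports Defs "HOL-Library.Multiset" "HOL-Combinatorics.Transposition"
begin

text \<open>
  The Kostka matrix is unitriangular for the dominance order, so if a symmetric function \<open>F\<close> has no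
  monomials \<open>x\<^sup>\<mu>\<close> with \<open>\<mu>\<close> strictly dominating \<open>\<lambda>\<close>, then the coefficients of \<open>s\<^sub>\<lambda>\<close> and of
  \<open>x\<^sup>\<lambda>\<close> in \<open>F\<close> agree.  The largest first part of an exponent of \<open>X\<^sub>G\<close> is \<open>\<alpha>(G)\<close>, since a color class is
  an independent set.  If \<open>\<alpha>(G) < \<alpha>(H)\<close>, choose \<open>\<lambda>\<close> maximal among the exponents of \<open>X\<^sub>H\<close> with first
  part \<open>\<alpha>(H)\<close>: neither \<open>X\<^sub>G\<close> nor \<open>X\<^sub>H\<close> has exponents above \<open>\<lambda>\<close>, and \<open>\<lambda>\<close> itself is no exponent of \<open>X\<^sub>G\<close>,
  so \<open>s\<^sub>\<lambda>\<close> has a negative coefficient in \<open>X\<^sub>s(G, H)\<close>.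

  The sign requires that the coefficient of the Schur function of a column in \<open>X\<^sub>G\<close> is positive.  This
  coefficient is an alternating sum over the compositions of \<open>n\<close>, and for \<open>X\<^sub>G\<close> it evaluates to the
  number of acyclic orientations of \<open>G\<close>.
\<close>

section \<open>Monomials and compositions\<close>

definition list_monomial :: "nat list \<Rightarrow> monomial" where
  "list_monomial b = (\<Sum>i<length b. Poly_Mapping.single (Suc i) (b ! i))"

lemma lookup_list_monomial:
  "poly_mapping.lookup (list_monomial b) k = (if 0 < k \<and> k \<le> length b then b ! (k - 1) else 0)"
proof -
  have "poly_mapping.lookup (list_monomial b) k = (\<Sum>i<length b. if Suc i = k then b ! i else 0)"
    by (simp add: list_monomial_def lookup_sum lookup_single when_def)
  also have "\<dots> = (\<Sum>i<length b. if k - 1 = i then (if 0 < k then b ! i else 0) else 0)"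
    by (intro sum.cong) auto
  also have "\<dots> = (if 0 < k \<and> k \<le> length b then b ! (k - 1) else 0)"
    by (subst sum.delta') auto
  finally show ?thesis .
qed

lemma sum_lookup_list_monomial: "(\<Sum>j\<le>k. poly_mapping.lookup (list_monomial b) j) = sum_list (take k b)"
proof (induction k)
  case 0
  then show ?case by (simp add: lookup_list_monomial)
next
  case (Suc k)
  then show ?case
    by (cases "k < length b") (simp_all add: lookup_list_monomial take_Suc_conv_app_nth)
qed

text \<open>Differences of partial sums recover the exponents. Partial sums are the convenient data
  because they count the cells or vertices with value at most \<open>k\<close>.\<close>

lemma eq_list_monomial_iff:
  "m = list_monomial b \<longleftrightarrow> (\<forall>k. (\<Sum>j\<le>k. poly_mapping.lookup m j) = sum_list (take k b))"
proof
  assume *: "\<forall>k. (\<Sum>j\<le>k. poly_mapping.lookup m j) = sum_list (take k b)"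
  have "poly_mapping.lookup m k = poly_mapping.lookup (list_monomial b) k" for k
  proof (cases k)
    case 0
    then show ?thesis using *[rule_format, of 0] by (simp add: lookup_list_monomial)
  next
    case (Suc i)
    then show ?thesis
      using *[rule_format, of k] *[rule_format, of i]
        sum_lookup_list_monomial[of b k] sum_lookup_list_monomial[of b i] by simp
  qed
  then show "m = list_monomial b" by (rule poly_mapping_eqI)
qed (simp add: sum_lookup_list_monomial)

lemma list_monomial_append_zeros: "list_monomial (b @ replicate z 0) = list_monomial b"
  by (rule poly_mapping_eqI) (auto simp: lookup_list_monomial nth_append)

lemma exists_list_monomial:
  assumes "poly_mapping.lookup m 0 = 0"
  shows "\<exists>b. m = list_monomial b"
proof -
  obtain K where K: "\<And>k. k \<in> Poly_Mapping.keys m \<Longrightarrow> k \<le> K"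
    by (meson finite_keys finite_nat_set_iff_bounded_le)
  have "m = list_monomial (map (\<lambda>i. poly_mapping.lookup m (Suc i)) [0..<K])"
  proof (rule poly_mapping_eqI)
    fix k
    have "poly_mapping.lookup m k = 0" if "k > K" using K[of k] that by (auto simp: in_keys_iff)
    then show "poly_mapping.lookup m k = poly_mapping.lookup (list_monomial (map (\<lambda>i. poly_mapping.lookup m (Suc i)) [0..<K])) k"
      using assms by (cases k) (auto simp: lookup_list_monomial)
  qed
  then show ?thesis by blast
qed

lemma lookup_monomial_of:
  assumes "finite A"
  shows "poly_mapping.lookup (monomial_of f A) k = card {a \<in> A. f a = k}"
  using assms
  by (simp add: monomial_of_def lookup_sum lookup_single when_def sum.If_cases Int_def)

lemma sum_lookup_monomial_of:
  assumes "finite A"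
  shows "(\<Sum>j\<le>k. poly_mapping.lookup (monomial_of f A) j) = card {a \<in> A. f a \<le> k}"
proof -
  have "(\<Sum>j\<le>k. poly_mapping.lookup (monomial_of f A) j) = (\<Sum>j\<le>k. card {a \<in> A. f a = j})"
    by (simp add: lookup_monomial_of assms)
  also have "\<dots> = card (\<Union>j\<in>{..k}. {a \<in> A. f a = j})"
    using assms by (subst card_UN_disjoint) auto
  also have "(\<Union>j\<in>{..k}. {a \<in> A. f a = j}) = {a \<in> A. f a \<le> k}" by auto
  finally show ?thesis .
qed

lemma monomial_of_eq_list_monomial_iff:
  assumes "finite A"
  shows "monomial_of f A = list_monomial b \<longleftrightarrow> (\<forall>k. card {a \<in> A. f a \<le> k} = sum_list (take k b))"
  by (simp add: eq_list_monomial_iff sum_lookup_monomial_of assms)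

lemma monomial_of_eq_list_monomialD:
  assumes "finite A" "monomial_of f A = list_monomial b" "a \<in> A"
  shows "1 \<le> f a" and "f a \<le> length b"
proof -
  have "card {x \<in> A. f x = f a} \<noteq> 0" using assms(1,3) by auto
  then have "poly_mapping.lookup (list_monomial b) (f a) \<noteq> 0"
    by (simp only: assms(2)[symmetric] lookup_monomial_of[OF assms(1)] not_False_eq_True)
  then show "1 \<le> f a" and "f a \<le> length b"
    by (auto simp: lookup_list_monomial split: if_splits)
qed

section \<open>Compositions and alternating sums over chains\<close>

definition compositions :: "nat \<Rightarrow> nat list set" where
  "compositions n = {b. sum_list b = n \<and> (\<forall>c\<in>set b. 0 < c)}"

lemma length_le_sum_list: "\<forall>c\<in>set b. (0::nat) < c \<Longrightarrow> length b \<le> sum_list b"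
  by (induction b) auto

lemma finite_compositions: "finite (compositions n)"
proof (rule finite_subset)
  show "compositions n \<subseteq> {b. set b \<subseteq> {..n} \<and> length b \<le> n}"
    by (auto simp: compositions_def member_le_sum_list length_le_sum_list)
qed (simp add: finite_lists_length_le)

lemma compositions_0: "compositions 0 = {[]}"
  using hd_in_set by (fastforce simp: compositions_def)

text \<open>Splitting off the last part matches the removal of the largest entries of a tableau or
  of the last color class of a coloring.\<close>

lemma sum_compositions:
  fixes f :: "nat list \<Rightarrow> 'b::comm_monoid_add"
  assumes "n > 0"
  shows "(\<Sum>b\<in>compositions n. f b) = (\<Sum>c = 1..n. \<Sum>b\<in>compositions (n - c). f (b @ [c]))"
proof -
  have "(\<Sum>c = 1..n. \<Sum>b\<in>compositions (n - c). f (b @ [c]))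
      = (\<Sum>(c, b)\<in>(SIGMA c:{1..n}. compositions (n - c)). f (b @ [c]))"
    by (rule sum.Sigma) (auto simp: finite_compositions)
  also have "\<dots> = (\<Sum>b\<in>compositions n. f b)"
  proof (rule sum.reindex_bij_witness[where i = "\<lambda>b. (last b, butlast b)" and j = "\<lambda>(c, b). b @ [c]"])
    fix b assume b: "b \<in> compositions n"
    then have "b \<noteq> []" using assms by (auto simp: compositions_def)
    then obtain b' c where "b = b' @ [c]" by (metis rev_exhaust)
    then show "(case (last b, butlast b) of (c, b) \<Rightarrow> b @ [c]) = b"
      and "(last b, butlast b) \<in> (SIGMA c:{1..n}. compositions (n - c))"
      using b by (auto simp: compositions_def)
  qed (auto simp: compositions_def)
  finally show ?thesis by simp
qed

text \<open>
  Here \<open>N x b\<close> counts the chains from an object of size 0 up to \<open>x\<close> with step sizes \<open>b\<close>, where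
  \<open>Y x\<close> is the set of possible predecessors of \<open>x\<close>, including \<open>x\<close> itself.
\<close>

lemma alternating_chain_sum:
  fixes N :: "'x \<Rightarrow> nat list \<Rightarrow> nat" and f :: "'x \<Rightarrow> rat"
  assumes N_Nil: "\<And>x. x \<in> X \<Longrightarrow> sz x = 0 \<Longrightarrow> N x [] = 1"
    and N_snoc: "\<And>x b c. x \<in> X \<Longrightarrow> 0 < c \<Longrightarrow> N x (b @ [c]) = (\<Sum>y | y \<in> Y x \<and> sz y + c = sz x. N y b)"
    and Y: "\<And>x. x \<in> X \<Longrightarrow> finite (Y x) \<and> Y x \<subseteq> X \<and> x \<in> Y x"
    and sz: "\<And>x y. x \<in> X \<Longrightarrow> y \<in> Y x \<Longrightarrow> y \<noteq> x \<Longrightarrow> sz y < sz x"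
    and f_0: "\<And>x. x \<in> X \<Longrightarrow> sz x = 0 \<Longrightarrow> f x = 1"
    and f_Y: "\<And>x. x \<in> X \<Longrightarrow> 0 < sz x \<Longrightarrow> (\<Sum>y\<in>Y x. f y) = 0"
    and x: "x \<in> X"
  shows "(\<Sum>b\<in>compositions (sz x). (- 1) ^ length b * of_nat (N x b)) = f x"
  using x
proof (induction "sz x" arbitrary: x rule: less_induct)
  case less
  let ?a = "\<lambda>x. \<Sum>b\<in>compositions (sz x). (- 1) ^ length b * of_nat (N x b) :: rat"
  show ?case
  proof (cases "sz x = 0")
    case True
    then show ?thesis using less N_Nil f_0 by (simp add: compositions_0)
  next
    case False
    have fin: "finite (Y x)" and "x \<in> Y x" using Y[OF less.prems] by auto
    \<comment> \<open>Splitting off the last step \<open>c\<close> exposes the predecessor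
      \<open>y\<close>; the longer list contributes the minus sign of the next line.\<close>
    have "?a x = (\<Sum>c = 1..sz x. \<Sum>b\<in>compositions (sz x - c).
        (- 1) ^ length (b @ [c]) * of_nat (\<Sum>y | y \<in> Y x \<and> sz y + c = sz x. N y b))"
      using False less.prems by (subst sum_compositions) (auto intro!: sum.cong simp: N_snoc)
    also have "\<dots> = - (\<Sum>c = 1..sz x. \<Sum>y | y \<in> Y x \<and> sz y + c = sz x. \<Sum>b\<in>compositions (sz x - c).
        (- 1) ^ length b * of_nat (N y b))"
      by (subst sum.swap) (simp add: sum_negf sum_distrib_left)
    also have "\<dots> = - (\<Sum>c = 1..sz x. \<Sum>y | y \<in> Y x \<and> sz y + c = sz x. f y)"
    proof (intro arg_cong[where f = uminus] sum.cong refl)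
      fix c y assume "c \<in> {1..sz x}" "y \<in> {y. y \<in> Y x \<and> sz y + c = sz x}"
      then have "y \<in> Y x" "sz x - c = sz y" "sz y < sz x" by auto
      then show "(\<Sum>b\<in>compositions (sz x - c). (- 1) ^ length b * of_nat (N y b)) = f y"
        using less.hyps[of y] Y[OF less.prems] by auto
    qed
    \<comment> \<open>The step \<open>c\<close> is determined by \<open>y\<close>, and
      \<open>c > 0\<close> excludes exactly \<open>y = x\<close>. The sum over the other
      predecessors is then \<open>- f x\<close> by \<open>f_Y\<close>.\<close>
    also have "\<dots> = - (\<Sum>(c, y)\<in>(SIGMA c:{1..sz x}. {y. y \<in> Y x \<and> sz y + c = sz x}). f y)"
      using fin by (subst sum.Sigma) auto
    also have "\<dots> = - (\<Sum>y\<in>Y x - {x}. f y)"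
      by (intro arg_cong[where f = uminus]
          sum.reindex_bij_witness[where j = snd and i = "\<lambda>y. (sz x - sz y, y)"])
        (use sz[OF less.prems] in \<open>force simp: less_imp_le Suc_le_eq\<close>)+
    also have "\<dots> = f x"
      using sum.remove[OF fin \<open>x \<in> Y x\<close>, of f] f_Y[OF less.prems] False by simp
    finally show ?thesis .
  qed
qed

section \<open>Gelfand--Tsetlin patterns\<close>

text \<open>
  The entry \<open>g k i\<close> is the number of entries at most \<open>k\<close> in row \<open>i\<close> of a semistandard tableau of shape
  \<open>p\<close> with at most \<open>L\<close> rows.
\<close>

definition gt_patterns :: "nat \<Rightarrow> (nat \<Rightarrow> nat) \<Rightarrow> nat list \<Rightarrow> (nat \<Rightarrow> nat \<Rightarrow> nat) set" where
  "gt_patterns L p b = {g. g 0 = (\<lambda>i. 0) \<and>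
     (\<forall>k i. g k i \<le> g (Suc k) i \<and> g (Suc k) (Suc i) \<le> g k i) \<and>
     (\<forall>k\<ge>length b. g k = p) \<and>
     (\<forall>k. (\<Sum>i<L. g k i) = sum_list (take k b))}"

text \<open>Padding with zeros makes a shape a function on all row indices, so interlacing needs no
  boundary cases.\<close>

definition part :: "nat list \<Rightarrow> nat \<Rightarrow> nat" where
  "part l i = (if i < length l then l ! i else 0)"

lemma gt_patternsD:
  assumes "g \<in> gt_patterns L p b"
  shows "g 0 i = 0" and "g k i \<le> g (Suc k) i" and "g (Suc k) (Suc i) \<le> g k i"
    and "length b \<le> k \<Longrightarrow> g k = p" and "(\<Sum>i<L. g k i) = sum_list (take k b)"
  using assms by (auto simp: gt_patterns_def)

lemma gt_patterns_mono:
  assumes "g \<in> gt_patterns L p b" "k \<le> k'"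
  shows "g k i \<le> g k' i"
  using gt_patternsD(2)[OF assms(1)] assms(2) by (rule lift_Suc_mono_le)

lemma gt_patterns_le:
  assumes "g \<in> gt_patterns L p b"
  shows "g k i \<le> p i"
proof -
  have "g k i \<le> g (max k (length b)) i" by (rule gt_patterns_mono[OF assms]) simp
  then show ?thesis using gt_patternsD(4)[OF assms, of "max k (length b)"] by simp
qed

text \<open>In terms of tableaux: columns increase strictly from at least 1, so row \<open>i\<close>
  (counted from 0) has no entry below \<open>i + 1\<close>.\<close>

lemma gt_patterns_eq_0:
  assumes "g \<in> gt_patterns L p b" "k \<le> i"
  shows "g k i = 0"
  using assms(2)
proof (induction k arbitrary: i)
  case 0
  then show ?case using gt_patternsD(1)[OF assms(1)] by simp
next
  case (Suc k)
  then obtain j where "i = Suc j" "k \<le> j" by (cases i) auto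
  then show ?case using Suc.IH[of j] gt_patternsD(3)[OF assms(1), of k j] by simp
qed

lemma gt_patterns_sum:
  assumes "g \<in> gt_patterns L p b"
  shows "(\<Sum>i<L. p i) = sum_list b"
  using gt_patternsD(4)[OF assms, of "length b"] gt_patternsD(5)[OF assms, of "length b"] by simp

lemma part_antimono: "is_partition l \<Longrightarrow> part l (Suc i) \<le> part l i"
  by (auto simp: is_partition_def part_def sorted_wrt_iff_nth_less)

lemma sum_part: "(\<Sum>i<k. part l i) = sum_list (take k l)"
proof (induction k)
  case (Suc k)
  then show ?case
    by (cases "k < length l") (auto simp: part_def take_Suc_conv_app_nth)
qed simp

lemma downward_closed_eq_lessThan_card:
  fixes A :: "nat set"
  assumes "finite A" "\<And>i j. j \<in> A \<Longrightarrow> i \<le> j \<Longrightarrow> i \<in> A"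
  shows "A = {..<card A}"
proof -
  obtain n where "A = {..<n}"
  proof (cases "A = {}")
    case False
    then have "A = {..<Suc (Max A)}"
      using assms(2)[OF Max_in[OF assms(1)]] Max_ge[OF assms(1)] by (auto simp: less_Suc_eq_le)
    then show ?thesis using that by blast
  qed (use that[of 0] in auto)
  then show ?thesis by simp
qed

section \<open>The bijection between semistandard tableaux and patterns\<close>

lemma finite_young_diagram: "finite (young_diagram l)"
proof -
  have "young_diagram l = (SIGMA i:{..<length l}. {..<l ! i})"
    by (auto simp: young_diagram_def)
  then show ?thesis by simp
qed

lemma mem_young_diagram_iff: "(i, j) \<in> young_diagram l \<longleftrightarrow> j < part l i"
  by (auto simp: young_diagram_def part_def)

lemma card_young_diagram_rows:
  assumes "\<And>i. {j. (i, j) \<in> young_diagram l \<and> P i j} = {..<f i}"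
  shows "card {c \<in> young_diagram l. case c of (i, j) \<Rightarrow> P i j} = (\<Sum>i<length l. f i)"
proof -
  have "{c \<in> young_diagram l. case c of (i, j) \<Rightarrow> P i j} = (SIGMA i:{..<length l}. {..<f i})"
    using assms by (auto simp: young_diagram_def set_eq_iff)
  then show ?thesis by simp
qed

definition ssyt_to_gt :: "nat list \<Rightarrow> (nat \<times> nat \<Rightarrow> nat) \<Rightarrow> nat \<Rightarrow> nat \<Rightarrow> nat" where
  "ssyt_to_gt l T k i = card {j. (i, j) \<in> young_diagram l \<and> T (i, j) \<le> k}"

text \<open>Inverse of \<open>ssyt_to_gt\<close>: a cell receives the first stage at which its row
  has grown past it. The restriction matches the extensional tableaux in
  \<open>ssyt\<close>.\<close>

definition gt_to_ssyt :: "nat list \<Rightarrow> (nat \<Rightarrow> nat \<Rightarrow> nat) \<Rightarrow> nat \<times> nat \<Rightarrow> nat" where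
  "gt_to_ssyt l g = restrict (\<lambda>(i, j). LEAST k. j < g k i) (young_diagram l)"

lemma ssytD:
  assumes "T \<in> ssyt l"
  shows "(i, j) \<in> young_diagram l \<Longrightarrow> 1 \<le> T (i, j)"
    and "(i, Suc j) \<in> young_diagram l \<Longrightarrow> T (i, j) \<le> T (i, Suc j)"
    and "(Suc i, j) \<in> young_diagram l \<Longrightarrow> T (i, j) < T (Suc i, j)"
  using assms by (auto simp: ssyt_def PiE_iff)

lemma ssyt_row_mono:
  assumes "T \<in> ssyt l" "(i, j') \<in> young_diagram l" "j \<le> j'"
  shows "T (i, j) \<le> T (i, j')"
  using assms(3,2)
proof (induction j' rule: dec_induct)
  case (step n)
  then have "(i, n) \<in> young_diagram l" by (auto simp: young_diagram_def)
  then show ?case using step ssytD(2)[OF assms(1)] order_trans by blast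
qed simp

lemma ssyt_row_eq:
  assumes "T \<in> ssyt l"
  shows "{j. (i, j) \<in> young_diagram l \<and> T (i, j) \<le> k} = {..<ssyt_to_gt l T k i}"
  unfolding ssyt_to_gt_def
proof (rule downward_closed_eq_lessThan_card)
  have "{j. (i, j) \<in> young_diagram l \<and> T (i, j) \<le> k} \<subseteq> {..<part l i}"
    by (auto simp: mem_young_diagram_iff)
  then show "finite {j. (i, j) \<in> young_diagram l \<and> T (i, j) \<le> k}"
    by (rule finite_subset) simp
next
  fix j' j assume "j' \<in> {j. (i, j) \<in> young_diagram l \<and> T (i, j) \<le> k}" "j \<le> j'"
  then show "j \<in> {j. (i, j) \<in> young_diagram l \<and> T (i, j) \<le> k}"
    using ssyt_row_mono[OF assms, of i j' j] by (auto simp: mem_young_diagram_iff)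
qed

lemma le_iff_less_ssyt_to_gt:
  assumes "T \<in> ssyt l" "(i, j) \<in> young_diagram l"
  shows "T (i, j) \<le> k \<longleftrightarrow> j < ssyt_to_gt l T k i"
  using ssyt_row_eq[OF assms(1), of i k] assms(2) by auto

text \<open>The second interlacing inequality is column strictness: above an entry at most
  \<open>Suc k\<close> stands an entry at most \<open>k\<close>.\<close>

lemma ssyt_to_gt_mem:
  assumes l: "is_partition l" and T: "T \<in> ssyt l" and wt: "monomial_of T (young_diagram l) = list_monomial b"
  shows "ssyt_to_gt l T \<in> gt_patterns (length l) (part l) b"
  unfolding gt_patterns_def
proof (intro CollectI conjI allI impI ext)
  let ?g = "ssyt_to_gt l T"
  show "?g 0 i = 0" for i
  proof -
    have "{j. (i, j) \<in> young_diagram l \<and> T (i, j) \<le> 0} = {}" using ssytD(1)[OF T] by fastforce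
    then show ?thesis unfolding ssyt_to_gt_def by (simp only: card.empty)
  qed
  show "?g k i \<le> ?g (Suc k) i" for k i
  proof -
    have "{..<?g k i} \<subseteq> {..<?g (Suc k) i}"
      unfolding ssyt_row_eq[OF T, symmetric] by auto
    then show ?thesis by simp
  qed
  show "?g (Suc k) (Suc i) \<le> ?g k i" for k i
  proof -
    have "{..<?g (Suc k) (Suc i)} \<subseteq> {..<?g k i}"
      unfolding ssyt_row_eq[OF T, symmetric]
    proof safe
      fix j assume j: "(Suc i, j) \<in> young_diagram l" "T (Suc i, j) \<le> Suc k"
      then show "(i, j) \<in> young_diagram l"
        using part_antimono[OF l, of i] by (simp add: mem_young_diagram_iff)
      show "T (i, j) \<le> k" using ssytD(3)[OF T j(1)] j(2) by simp
    qed
    then show ?thesis by simp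
  qed
  show sums: "(\<Sum>i<length l. ?g k i) = sum_list (take k b)" for k
  proof -
    have "sum_list (take k b) = card {c \<in> young_diagram l. T c \<le> k}"
      using wt by (simp add: monomial_of_eq_list_monomial_iff[OF finite_young_diagram])
    also have "{c \<in> young_diagram l. T c \<le> k} =
        {c \<in> young_diagram l. case c of (i, j) \<Rightarrow> T (i, j) \<le> k}" by auto
    also have "card \<dots> = (\<Sum>i<length l. ?g k i)"
      by (rule card_young_diagram_rows[OF ssyt_row_eq[OF T]])
    finally show ?thesis by simp
  qed
  show "?g k i = part l i" if "length b \<le> k" for k i
  proof -
    have le_k: "T c \<le> k" if "c \<in> young_diagram l" for c
      using monomial_of_eq_list_monomialD(2)[OF finite_young_diagram wt that] \<open>length b \<le> k\<close> by simp
    have "{..<?g k i} = {..<part l i}"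
      unfolding ssyt_row_eq[OF T, symmetric] using le_k by (auto simp: mem_young_diagram_iff)
    then show ?thesis by simp
  qed
qed

lemma gt_to_ssyt_le_iff:
  assumes g: "g \<in> gt_patterns (length l) (part l) b" and c: "(i, j) \<in> young_diagram l"
  shows "gt_to_ssyt l g (i, j) \<le> k \<longleftrightarrow> j < g k i"
proof -
  \<comment> \<open>At stage \<open>length b\<close> the row has its full length, so some stage
    qualifies and the least one exists.\<close>
  have "j < g (length b) i" using gt_patternsD(4)[OF g] c by (simp add: mem_young_diagram_iff)
  then have *: "j < g (LEAST k. j < g k i) i" by (rule LeastI)
  have "(LEAST k. j < g k i) \<le> k \<longleftrightarrow> j < g k i"
    using * gt_patterns_mono[OF g, of _ k i] by (meson Least_le less_le_trans)
  then show ?thesis using c by (simp add: gt_to_ssyt_def)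
qed

lemma gt_to_ssyt_mem:
  assumes l: "is_partition l" and g: "g \<in> gt_patterns (length l) (part l) b"
  shows "gt_to_ssyt l g \<in> ssyt l" and "monomial_of (gt_to_ssyt l g) (young_diagram l) = list_monomial b"
proof -
  let ?T = "gt_to_ssyt l g"
  note le_iff = gt_to_ssyt_le_iff[OF g]
  have pos: "1 \<le> ?T (i, j)" if "(i, j) \<in> young_diagram l" for i j
    using le_iff[OF that, of 0] gt_patternsD(1)[OF g] by simp
  show "?T \<in> ssyt l"
    unfolding ssyt_def
  proof (intro CollectI conjI allI impI)
    show "?T \<in> young_diagram l \<rightarrow>\<^sub>E {1..}"
      using pos by (auto simp: PiE_iff gt_to_ssyt_def)
    show "?T (i, j) \<le> ?T (i, Suc j)" if "(i, Suc j) \<in> young_diagram l" for i j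
    proof -
      have "(i, j) \<in> young_diagram l" using that by (simp add: mem_young_diagram_iff)
      then show ?thesis using le_iff[OF that, of "?T (i, Suc j)"] le_iff by simp
    qed
    show "?T (i, j) < ?T (Suc i, j)" if Sij: "(Suc i, j) \<in> young_diagram l" for i j
    proof -
      have ij: "(i, j) \<in> young_diagram l"
        using Sij part_antimono[OF l, of i] by (simp add: mem_young_diagram_iff)
      obtain k where k: "?T (Suc i, j) = Suc k"
        using pos[OF Sij] by (auto simp: Suc_le_eq gr0_conv_Suc)
      then have "j < g (Suc k) (Suc i)" using le_iff[OF Sij, of "Suc k"] by simp
      then have "?T (i, j) \<le> k" using gt_patternsD(3)[OF g, of k i] le_iff[OF ij, of k] by simp
      then show ?thesis using k by simp
    qed
  qed
  show "monomial_of ?T (young_diagram l) = list_monomial b"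
    unfolding monomial_of_eq_list_monomial_iff[OF finite_young_diagram]
  proof
    fix k
    have *: "{j. (i, j) \<in> young_diagram l \<and> ?T (i, j) \<le> k} = {..<g k i}" for i
      using le_iff gt_patterns_le[OF g, of k i] by (auto simp: mem_young_diagram_iff)
    have "{c \<in> young_diagram l. ?T c \<le> k} =
        {c \<in> young_diagram l. case c of (i, j) \<Rightarrow> ?T (i, j) \<le> k}" by auto
    also have "card \<dots> = (\<Sum>i<length l. g k i)"
      by (rule card_young_diagram_rows[OF *])
    finally show "card {c \<in> young_diagram l. ?T c \<le> k} = sum_list (take k b)"
      by (simp add: gt_patternsD(5)[OF g])
  qed
qed

text \<open>The Kostka number becomes a count of patterns, in which adjacent weights can be swapped
  and the last weight removed by simple operations.\<close>

lemma schur_list_monomial: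
  assumes l: "is_partition l"
  shows "schur l (list_monomial b) = of_nat (card (gt_patterns (length l) (part l) b))"
proof -
  have "bij_betw (ssyt_to_gt l) {T \<in> ssyt l. monomial_of T (young_diagram l) = list_monomial b}
      (gt_patterns (length l) (part l) b)"
  proof (rule bij_betw_byWitness[where f' = "gt_to_ssyt l"])
    show "\<forall>T\<in>{T \<in> ssyt l. monomial_of T (young_diagram l) = list_monomial b}.
        gt_to_ssyt l (ssyt_to_gt l T) = T"
    proof (intro ballI ext)
      fix T :: "nat \<times> nat \<Rightarrow> nat" and c :: "nat \<times> nat"
      assume "T \<in> {T \<in> ssyt l. monomial_of T (young_diagram l) = list_monomial b}"
      then have T: "T \<in> ssyt l" "monomial_of T (young_diagram l) = list_monomial b" by auto
      obtain i j where c: "c = (i, j)" by (rule prod.exhaust)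
      show "gt_to_ssyt l (ssyt_to_gt l T) c = T c"
      proof (cases "c \<in> young_diagram l")
        case True
        have "gt_to_ssyt l (ssyt_to_gt l T) c \<le> k \<longleftrightarrow> T c \<le> k" for k
          using gt_to_ssyt_le_iff[OF ssyt_to_gt_mem[OF l T]] le_iff_less_ssyt_to_gt[OF T(1)] True c
          by blast
        then show ?thesis by (metis order_antisym order_refl)
      next
        case False
        moreover have "T \<in> young_diagram l \<rightarrow>\<^sub>E {1..}" using T(1) by (simp add: ssyt_def)
        ultimately show ?thesis using PiE_arb[of T] by (simp add: gt_to_ssyt_def)
      qed
    qed
    show "\<forall>g\<in>gt_patterns (length l) (part l) b. ssyt_to_gt l (gt_to_ssyt l g) = g"
    proof (intro ballI ext)
      fix g k i assume g: "g \<in> gt_patterns (length l) (part l) b"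
      have "{j. (i, j) \<in> young_diagram l \<and> gt_to_ssyt l g (i, j) \<le> k} = {..<g k i}"
        using gt_to_ssyt_le_iff[OF g] gt_patterns_le[OF g, of k i] by (auto simp: mem_young_diagram_iff)
      then show "ssyt_to_gt l (gt_to_ssyt l g) k i = g k i"
        unfolding ssyt_to_gt_def by simp
    qed
  qed (use ssyt_to_gt_mem[OF l] gt_to_ssyt_mem[OF l] in auto)
  then show ?thesis
    by (simp add: schur_def bij_betw_same_card)
qed

text \<open>
  The rows adjacent to row \<open>k\<close> confine each entry of row \<open>k\<close> to an interval independently of the
  other entries; reflecting all these intervals is the Bender--Knuth involution.
\<close>

definition lower_end :: "(nat \<Rightarrow> nat) \<Rightarrow> (nat \<Rightarrow> nat) \<Rightarrow> nat \<Rightarrow> nat" where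
  "lower_end p q i = max (p i) (q (Suc i))"

definition upper_end :: "(nat \<Rightarrow> nat) \<Rightarrow> (nat \<Rightarrow> nat) \<Rightarrow> nat \<Rightarrow> nat" where
  "upper_end p q i = (case i of 0 \<Rightarrow> q 0 | Suc j \<Rightarrow> min (q i) (p j))"

definition toggle :: "nat \<Rightarrow> (nat \<Rightarrow> nat \<Rightarrow> nat) \<Rightarrow> nat \<Rightarrow> nat \<Rightarrow> nat" where
  "toggle k g = g(k := (\<lambda>i. lower_end (g (k - 1)) (g (Suc k)) i + upper_end (g (k - 1)) (g (Suc k)) i - g k i))"

text \<open>\<open>lower_end p q i\<close> and \<open>upper_end p q (Suc i)\<close> are the maximum
  and the minimum of the same pair \<open>p i\<close>, \<open>q (Suc i)\<close>, so together they
  contribute the sum of that pair.\<close>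

lemma sum_ends:
  assumes "q L = 0"
  shows "(\<Sum>i<L. lower_end p q i + upper_end p q i) = (\<Sum>i<L. p i) + (\<Sum>i<L. q i)"
proof -
  \<comment> \<open>The upper ends run one index further than the lower ends so that every pair is
    complete; the lower end still missing equals \<open>p M\<close> because
    \<open>q L = 0\<close>.\<close>
  have *: "(\<Sum>i<L. lower_end p q i) + (\<Sum>i<Suc L. upper_end p q i) = (\<Sum>i<L. p i) + (\<Sum>i<Suc L. q i)" for L
  proof (induction L)
    case (Suc L)
    have "lower_end p q L + upper_end p q (Suc L) = p L + q (Suc L)"
      by (simp add: lower_end_def upper_end_def)
    then show ?case using Suc by simp
  qed (simp add: upper_end_def)
  show ?thesis
  proof (cases L)
    case (Suc M)
    have "lower_end p q M = p M" using assms Suc by (simp add: lower_end_def)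
    then show ?thesis using *[of M] Suc by (simp add: sum.distrib)
  qed simp
qed

lemma gt_patterns_between_ends:
  assumes "g \<in> gt_patterns L p b" "0 < k"
  shows "lower_end (g (k - 1)) (g (Suc k)) i \<le> g k i" and "g k i \<le> upper_end (g (k - 1)) (g (Suc k)) i"
  using gt_patternsD(2,3)[OF assms(1), of "k - 1"] gt_patternsD(2,3)[OF assms(1), of k] assms(2)
  by (auto simp: lower_end_def upper_end_def split: nat.splits)

lemma toggle_toggle:
  assumes "g \<in> gt_patterns L p b" "0 < k"
  shows "toggle k (toggle k g) = g"
proof (intro ext)
  fix k' i
  show "toggle k (toggle k g) k' i = g k' i"
    using gt_patterns_between_ends[OF assms, of i] assms(2) by (cases "k' = k") (auto simp: toggle_def)
qed

text \<open>Reflection replaces the sum of row \<open>k\<close> by the sum of its two neighbours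
  minus the old sum, which exchanges the increments \<open>a\<close> and \<open>b\<close>.
  Interlacing survives because the reflected entries stay between the same ends.\<close>

lemma toggle_mem:
  assumes g: "g \<in> gt_patterns L p (u @ [a, b] @ v)" and p: "p L = 0"
  shows "toggle (Suc (length u)) g \<in> gt_patterns L p (u @ [b, a] @ v)"
proof -
  define k where "k = Suc (length u)"
  let ?lo = "lower_end (g (k - 1)) (g (Suc k))" and ?hi = "upper_end (g (k - 1)) (g (Suc k))"
  have "0 < k" by (simp add: k_def)
  note ends = gt_patterns_between_ends[OF g this]
  have row_k: "toggle k g k i = ?lo i + ?hi i - g k i" for i by (simp add: toggle_def)
  have row: "toggle k g k' = g k'" if "k' \<noteq> k" for k' using that by (simp add: toggle_def)
  have "(\<Sum>i<L. toggle k g k i) + (\<Sum>i<L. g k i) = (\<Sum>i<L. ?lo i + ?hi i)"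
    unfolding sum.distrib[symmetric] using ends(2) by (intro sum.cong) (simp_all add: row_k trans_le_add2)
  also have "\<dots> = (\<Sum>i<L. g (k - 1) i) + (\<Sum>i<L. g (Suc k) i)"
    using gt_patterns_le[OF g, of "Suc k" L] p by (intro sum_ends) simp
  finally have sum_k: "(\<Sum>i<L. toggle k g k i) = sum_list u + b"
    by (simp add: gt_patternsD(5)[OF g]) (simp add: k_def)
  have "toggle k g \<in> gt_patterns L p (u @ [b, a] @ v)"
    unfolding gt_patterns_def
  proof (intro CollectI conjI allI impI)
    show "toggle k g 0 = (\<lambda>i. 0)" using row[of 0] \<open>0 < k\<close> gt_patternsD(1)[OF g] by auto
    fix k' i
    have bounds: "?lo i \<le> toggle k g k i" "toggle k g k i \<le> ?hi i" for i
      using ends[of i] by (simp_all add: row_k)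
    have lo: "g (k - 1) i \<le> ?lo i" "g (Suc k) (Suc i) \<le> ?lo i" for i by (auto simp: lower_end_def)
    have hi: "?hi i \<le> g (Suc k) i" "?hi (Suc i) \<le> g (k - 1) i" for i by (auto simp: upper_end_def split: nat.split)
    consider (eq) "k' = k" | (Suc) "Suc k' = k" | (neq) "k' \<noteq> k" "Suc k' \<noteq> k" by blast
    then show "toggle k g k' i \<le> toggle k g (Suc k') i"
    proof cases
      case eq
      then show ?thesis using order_trans[OF bounds(2) hi(1), of i] by (simp add: row)
    next
      case Suc
      then have "toggle k g k' i = g (k - 1) i" using row[of k'] by auto
      then show ?thesis using Suc order_trans[OF lo(1) bounds(1), of i] by simp
    next
      case neq
      then show ?thesis by (simp add: row gt_patternsD(2)[OF g])
    qed
    consider (eq) "k' = k" | (Suc) "Suc k' = k" | (neq) "k' \<noteq> k" "Suc k' \<noteq> k" by blast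
    then show "toggle k g (Suc k') (Suc i) \<le> toggle k g k' i"
    proof cases
      case eq
      then show ?thesis using order_trans[OF lo(2) bounds(1), of i] by (simp add: row)
    next
      case Suc
      then have "toggle k g k' i = g (k - 1) i" using row[of k'] by auto
      then show ?thesis using Suc order_trans[OF bounds(2) hi(2), of i] by simp
    next
      case neq
      then show ?thesis by (simp add: row gt_patternsD(3)[OF g])
    qed
  next
    fix k' assume "length (u @ [b, a] @ v) \<le> k'"
    then show "toggle k g k' = p" using gt_patternsD(4)[OF g, of k'] row[of k'] by (simp add: k_def)
  next
    fix k'
    show "(\<Sum>i<L. toggle k g k' i) = sum_list (take k' (u @ [b, a] @ v))"
    proof (cases "k' = k")
      case True
      then show ?thesis using sum_k by (simp add: k_def)
    next
      case False
      \<comment> \<open>The partial sums of the two weights differ only at \<open>k\<close>.\<close>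
      have "sum_list (take k' (u @ [a, b] @ v)) = sum_list (take k' (u @ [b, a] @ v))"
        using False by (cases "k' - length u" rule: nat.exhaust; cases "k' - length u - 1")
          (auto simp: k_def take_Cons')
      then show ?thesis using gt_patternsD(5)[OF g, of k'] False by (simp add: row)
    qed
  qed
  then show ?thesis by (simp add: k_def)
qed

lemma card_gt_patterns_swap:
  assumes p: "p L = 0"
  shows "card (gt_patterns L p (u @ [a, b] @ v)) = card (gt_patterns L p (u @ [b, a] @ v))"
proof (rule bij_betw_same_card)
  show "bij_betw (toggle (Suc (length u)))
      (gt_patterns L p (u @ [a, b] @ v)) (gt_patterns L p (u @ [b, a] @ v))"
    by (rule bij_betw_byWitness[where f' = "toggle (Suc (length u))"])
      (use toggle_toggle toggle_mem p in fastforce)+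
qed

section \<open>Dominance order\<close>

text \<open>Stated for arbitrary lists, so that weights need not be sorted.\<close>

definition dominates :: "nat list \<Rightarrow> nat list \<Rightarrow> bool" where
  "dominates l m \<longleftrightarrow> sum_list l = sum_list m \<and> (\<forall>k. sum_list (take k m) \<le> sum_list (take k l))"

text \<open>On partitions this increases strictly along dominance, which turns maximality and
  induction in the dominance order into statements about natural numbers.\<close>

definition dominance_rank :: "nat list \<Rightarrow> nat" where
  "dominance_rank l = (\<Sum>k\<le>sum_list l. sum_list (take k l))"

lemma dominates_trans: "dominates l m \<Longrightarrow> dominates m q \<Longrightarrow> dominates l q"
  by (auto simp: dominates_def intro: order_trans)

lemma partition_eqI:
  assumes l: "is_partition l" and m: "is_partition m"
    and eq: "\<And>k. k \<le> sum_list l \<Longrightarrow> sum_list (take k l) = sum_list (take k m)" and sums: "sum_list l = sum_list m"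
  shows "l = m"
proof (rule nth_equalityI)
  \<comment> \<open>Positive parts bound the length by the size, so the partial sums up to
    \<open>sum_list l\<close> see every part.\<close>
  have len: "length l \<le> sum_list l" "length m \<le> sum_list l"
    using l m sums length_le_sum_list[of l] length_le_sum_list[of m] by (auto simp: is_partition_def)
  have part: "part l i = part m i" if "i < sum_list l" for i
    using eq[of i] eq[of "Suc i"] that by (simp flip: sum_part)
  have pos: "0 < part l i \<longleftrightarrow> i < length l" if "is_partition l" for l i
    using that by (auto simp: is_partition_def part_def)
  have "i < length l \<longleftrightarrow> i < length m" for i
    using part[of i] pos[OF l, of i] pos[OF m, of i] len by (metis less_le_trans)
  then show "length l = length m" by (meson linorder_neq_iff order_less_irrefl)
  then show "l ! i = m ! i" if "i < length l" for i
    using part[of i] that len by (simp add: part_def)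
qed

lemma dominance_rank_less:
  assumes "is_partition l" "is_partition m" "dominates l m" "l \<noteq> m"
  shows "dominance_rank m < dominance_rank l"
proof -
  have "\<exists>k\<le>sum_list l. sum_list (take k l) \<noteq> sum_list (take k m)"
    using partition_eqI assms by (metis dominates_def)
  then show ?thesis
    using assms(3) unfolding dominance_rank_def dominates_def
    by (metis (no_types, lifting) atMost_iff finite_atMost le_neq_implies_less sum_strict_mono_ex1)
qed

lemma gt_patterns_sum_Int:
  assumes "g \<in> gt_patterns L p b"
  shows "(\<Sum>i<L. g k i) = (\<Sum>i\<in>{..<L} \<inter> {..<k}. g k i)"
proof (rule sum.mono_neutral_right)
  show "\<forall>i\<in>{..<L} - {..<L} \<inter> {..<k}. g k i = 0"
  proof
    fix i assume "i \<in> {..<L} - {..<L} \<inter> {..<k}"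
    then have "k \<le> i" by auto
    then show "g k i = 0" by (rule gt_patterns_eq_0[OF assms])
  qed
qed auto

text \<open>At stage \<open>k\<close> only the first \<open>k\<close> rows can be nonzero, and each
  is bounded by its final length.\<close>

lemma gt_patterns_dominates:
  assumes "g \<in> gt_patterns (length l) (part l) m"
  shows "dominates l m"
  unfolding dominates_def
proof (intro conjI allI)
  show "sum_list l = sum_list m"
    using gt_patterns_sum[OF assms] by (simp add: sum_part)
  fix k
  have "sum_list (take k m) = (\<Sum>i<length l. g k i)" by (simp add: gt_patternsD(5)[OF assms])
  also have "\<dots> = (\<Sum>i\<in>{..<length l} \<inter> {..<k}. g k i)"
    by (rule gt_patterns_sum_Int[OF assms])
  also have "\<dots> \<le> (\<Sum>i<k. part l i)"
    by (rule order_trans[OF sum_mono sum_mono2]) (auto intro: gt_patterns_le[OF assms])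
  finally show "sum_list (take k m) \<le> sum_list (take k l)" by (simp add: sum_part)
qed

text \<open>When weight and shape agree, the dominance inequalities are equalities, which forces
  each row to be full as soon as it may be nonzero.\<close>

lemma gt_patterns_diagonal:
  assumes l: "is_partition l"
  shows "gt_patterns (length l) (part l) l = {\<lambda>k i. if i < k then part l i else 0}"
proof (intro equalityI subsetI)
  fix g assume g: "g \<in> gt_patterns (length l) (part l) l"
  have "g k i = (if i < k then part l i else 0)" for k i
  proof (cases "i < k")
    case True
    have out: "g k i = 0" if "length l \<le> i" for i
      using gt_patterns_le[OF g, of k i] that by (simp add: part_def)
    have "(\<Sum>i<k. part l i) = (\<Sum>i<length l. g k i)"
      by (simp add: gt_patternsD(5)[OF g] sum_part)
    also have "\<dots> = (\<Sum>i\<in>{..<length l} \<inter> {..<k}. g k i)"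
      by (rule gt_patterns_sum_Int[OF g])
    also have "\<dots> = (\<Sum>i<k. g k i)"
      by (rule sum.mono_neutral_left) (auto, metis out not_less order_less_irrefl)
    finally have "(\<Sum>i<k. g k i) = (\<Sum>i<k. part l i)" ..
    moreover have "g k j \<le> part l j" for j by (rule gt_patterns_le[OF g])
    \<comment> \<open>Termwise bounds with equal totals are termwise equalities.\<close>
    ultimately have "\<forall>j\<in>{..<k}. g k j = part l j"
      by (intro ballI) (metis sum_mono_inv[of "g k" "{..<k}" "part l"] finite_lessThan)
    then show ?thesis using True by simp
  qed (simp add: gt_patterns_eq_0[OF g])
  then show "g \<in> {\<lambda>k i. if i < k then part l i else 0}" by auto
next
  fix g assume "g \<in> {\<lambda>k i. if i < k then part l i else 0}"
  then have g: "g = (\<lambda>k i. if i < k then part l i else 0)" by simp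
  show "g \<in> gt_patterns (length l) (part l) l"
    unfolding gt_patterns_def g
  proof (intro CollectI conjI allI impI)
    fix k
    have "(\<Sum>i<length l. if i < k then part l i else 0) = (\<Sum>i\<in>{..<length l} \<inter> {..<k}. part l i)"
      by (simp add: sum.If_cases Int_def)
    also have "\<dots> = (\<Sum>i<k. part l i)"
      by (rule sum.mono_neutral_left) (auto simp: part_def)
    finally show "(\<Sum>i<length l. if i < k then part l i else 0) = sum_list (take k l)" by (simp add: sum_part)
  qed (use part_antimono[OF l] in \<open>auto simp: part_def fun_eq_iff\<close>)
qed

lemma schur_diagonal: "is_partition l \<Longrightarrow> schur l (list_monomial l) = 1"
  by (simp add: schur_list_monomial gt_patterns_diagonal)

lemma schur_nonzero_dominates:
  assumes "is_partition l" "schur l (list_monomial m) \<noteq> 0"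
  shows "dominates l m"
proof -
  have "gt_patterns (length l) (part l) m \<noteq> {}"
    using assms by (auto simp: schur_list_monomial)
  then show ?thesis using gt_patterns_dominates by blast
qed

section \<open>Alternating sums of Kostka numbers\<close>

text \<open>For a partition \<open>p\<close>, these are the shapes that remain after removing a
  horizontal strip.\<close>

definition horizontal_strips :: "(nat \<Rightarrow> nat) \<Rightarrow> (nat \<Rightarrow> nat) set" where
  "horizontal_strips p = {q. \<forall>i. p (Suc i) \<le> q i \<and> q i \<le> p i}"

text \<open>Removing the cells with the largest value \<open>Suc (length b)\<close> takes away a
  horizontal strip of size \<open>c\<close>. On patterns this means freezing from stage
  \<open>length b\<close> on.\<close>

lemma gt_patterns_snoc:
  assumes p: "\<And>i. p (Suc i) \<le> p i"
  shows "bij_betw (\<lambda>g k. g (min k (length b))) (gt_patterns L p (b @ [c]))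
    (\<Union>q\<in>{q \<in> horizontal_strips p. (\<Sum>i<L. q i) + c = (\<Sum>i<L. p i)}. gt_patterns L q b)"
    (is "bij_betw ?f ?A ?B")
proof (rule bij_betw_byWitness[where f' = "\<lambda>g k. if k \<le> length b then g k else p"])
  show "\<forall>g\<in>?A. (\<lambda>k. if k \<le> length b then ?f g k else p) = g"
    by (auto simp: fun_eq_iff gt_patterns_def)
  show "\<forall>g\<in>?B. ?f (\<lambda>k. if k \<le> length b then g k else p) = g"
    by (auto simp: fun_eq_iff gt_patterns_def min_def)
  show "?f ` ?A \<subseteq> ?B"
  proof
    fix h assume "h \<in> ?f ` ?A"
    then obtain g where h: "h = ?f g" and g: "g \<in> ?A" by blast
    have last: "g (Suc (length b)) = p" by (rule gt_patternsD(4)[OF g]) simp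
    have "g (length b) \<in> horizontal_strips p"
      using gt_patternsD(2,3)[OF g, of "length b"] last by (simp add: horizontal_strips_def)
    moreover have "(\<Sum>i<L. g (length b) i) + c = (\<Sum>i<L. p i)"
      using gt_patternsD(5)[OF g, of "length b"] gt_patternsD(5)[OF g, of "Suc (length b)"] last by simp
    moreover have "h \<in> gt_patterns L (g (length b)) b"
      unfolding gt_patterns_def
    proof (intro CollectI conjI allI impI)
      show "h 0 = (\<lambda>i. 0)" using gt_patternsD(1)[OF g] by (auto simp: h)
      fix k i
      show "h k i \<le> h (Suc k) i"
        by (auto simp: h intro: gt_patterns_mono[OF g])
      have "h (Suc k) (Suc i) \<le> g (Suc (min k (length b))) (Suc i)"
        by (auto simp: h intro: gt_patterns_mono[OF g])
      also have "\<dots> \<le> g (min k (length b)) i" by (rule gt_patternsD(3)[OF g])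
      finally show "h (Suc k) (Suc i) \<le> h k i" by (simp add: h)
    next
      fix k
      show "(\<Sum>i<L. h k i) = sum_list (take k b)"
        using gt_patternsD(5)[OF g, of "min k (length b)"] by (simp add: h min_def split: if_splits)
    qed (simp add: h)
    ultimately show "h \<in> ?B" by blast
  qed
  show "(\<lambda>g k. if k \<le> length b then g k else p) ` ?B \<subseteq> ?A"
  proof
    fix h assume "h \<in> (\<lambda>g k. if k \<le> length b then g k else p) ` ?B"
    then obtain g q where h: "h = (\<lambda>k. if k \<le> length b then g k else p)" and g: "g \<in> gt_patterns L q b"
      and q: "q \<in> horizontal_strips p" "(\<Sum>i<L. q i) + c = (\<Sum>i<L. p i)" by blast
    have last: "g (length b) = q" by (rule gt_patternsD(4)[OF g]) simp
    show "h \<in> ?A"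
      unfolding gt_patterns_def
    proof (intro CollectI conjI allI impI)
      show "h 0 = (\<lambda>i. 0)" using gt_patternsD(1)[OF g] by (auto simp: h)
      fix k i
      have "q i \<le> p i" "p (Suc i) \<le> q i" using q(1) by (auto simp: horizontal_strips_def)
      then show "h k i \<le> h (Suc k) i" and "h (Suc k) (Suc i) \<le> h k i"
        using gt_patternsD(2,3)[OF g, of k i] last p[of i] by (auto simp: h le_Suc_eq not_less_eq_eq le_antisym)
    next
      fix k
      show "(\<Sum>i<L. h k i) = sum_list (take k (b @ [c]))"
        using gt_patternsD(5)[OF g, of k] gt_patterns_sum[OF g] q(2) by (auto simp: h take_Cons')
    qed (auto simp: h)
  qed
qed

lemma finite_horizontal_strips:
  assumes "\<And>i. L \<le> i \<Longrightarrow> p i = 0"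
  shows "finite (horizontal_strips p)"
proof (rule finite_subset)
  show "horizontal_strips p \<subseteq> {q. \<forall>i. (i \<in> {..<L} \<longrightarrow> q i \<in> {..Max (p ` {..<L})}) \<and> (i \<notin> {..<L} \<longrightarrow> q i = 0)}"
  proof (intro subsetI CollectI allI conjI impI)
    fix q i assume q: "q \<in> horizontal_strips p"
    then have *: "q i \<le> p i" by (simp add: horizontal_strips_def)
    show "q i \<in> {..Max (p ` {..<L})}" if "i \<in> {..<L}"
      using * Max_ge[of "p ` {..<L}" "p i"] that by (auto intro: order_trans)
    show "q i = 0" if "i \<notin> {..<L}" using * assms[of i] that by simp
  qed
qed (rule finite_set_of_finite_funs; simp)

text \<open>Partitions with at most \<open>L\<close> rows, as functions. Removing horizontal strips
  stays in this class, so the recursion can run on it.\<close>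

definition bounded_shapes :: "nat \<Rightarrow> (nat \<Rightarrow> nat) set" where
  "bounded_shapes L = {p. (\<forall>i. p (Suc i) \<le> p i) \<and> (\<forall>i\<ge>L. p i = 0)}"

lemma horizontal_strips_bounded_shapes:
  assumes "p \<in> bounded_shapes L" "q \<in> horizontal_strips p"
  shows "q \<in> bounded_shapes L"
  using assms unfolding bounded_shapes_def horizontal_strips_def
  by (auto intro: order_trans) (metis bot_nat_0.extremum_uniqueI)

lemma gt_patterns_Nil:
  assumes "p \<in> bounded_shapes L"
  shows "gt_patterns L p [] = (if p = (\<lambda>i. 0) then {\<lambda>k i. 0} else {})"
  by (auto simp: gt_patterns_def fun_eq_iff)

lemma finite_gt_patterns:
  assumes "p \<in> bounded_shapes L"
  shows "finite (gt_patterns L p b)"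
  using assms
proof (induction b arbitrary: p rule: rev_induct)
  case Nil
  then show ?case by (simp add: gt_patterns_Nil)
next
  case (snoc c b)
  have p: "\<And>i. p (Suc i) \<le> p i" "\<And>i. L \<le> i \<Longrightarrow> p i = 0"
    using snoc.prems by (auto simp: bounded_shapes_def)
  show ?case
    unfolding bij_betw_finite[OF gt_patterns_snoc[where p = p, OF p(1)]]
    using finite_horizontal_strips[of L p, OF p(2)]
      snoc.IH horizontal_strips_bounded_shapes[OF snoc.prems] by auto
qed

lemma card_gt_patterns_snoc:
  assumes p: "p \<in> bounded_shapes L"
  shows "card (gt_patterns L p (b @ [c])) =
    (\<Sum>q | q \<in> horizontal_strips p \<and> (\<Sum>i<L. q i) + c = (\<Sum>i<L. p i). card (gt_patterns L q b))"
proof -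
  have p': "\<And>i. p (Suc i) \<le> p i" "\<And>i. L \<le> i \<Longrightarrow> p i = 0"
    using p by (auto simp: bounded_shapes_def)
  have "card (gt_patterns L p (b @ [c])) =
      card (\<Union>q\<in>{q \<in> horizontal_strips p. (\<Sum>i<L. q i) + c = (\<Sum>i<L. p i)}. gt_patterns L q b)"
    by (rule bij_betw_same_card[OF gt_patterns_snoc[where p = p, OF p'(1)]])
  also have "\<dots> = (\<Sum>q | q \<in> horizontal_strips p \<and> (\<Sum>i<L. q i) + c = (\<Sum>i<L. p i). card (gt_patterns L q b))"
  proof (rule card_UN_disjoint)
    show "finite {q \<in> horizontal_strips p. (\<Sum>i<L. q i) + c = (\<Sum>i<L. p i)}"
      using finite_horizontal_strips[of L p, OF p'(2)] by simp
    show "\<forall>q\<in>{q \<in> horizontal_strips p. (\<Sum>i<L. q i) + c = (\<Sum>i<L. p i)}. finite (gt_patterns L q b)"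
      using horizontal_strips_bounded_shapes[OF p] by (auto intro: finite_gt_patterns)
    show "\<forall>q\<in>{q \<in> horizontal_strips p. (\<Sum>i<L. q i) + c = (\<Sum>i<L. p i)}.
        \<forall>q'\<in>{q \<in> horizontal_strips p. (\<Sum>i<L. q i) + c = (\<Sum>i<L. p i)}.
          q \<noteq> q' \<longrightarrow> gt_patterns L q b \<inter> gt_patterns L q' b = {}"
      by (auto dest!: gt_patternsD(4)[OF _ order_refl])
  qed
  finally show ?thesis .
qed

text \<open>Sign-reversing involution: only remainders with all rows at most 1 count, and toggling
  the cell in the last nonempty row \<open>h\<close> of \<open>p\<close> pairs them off.\<close>

lemma sum_columns_horizontal_strips:
  assumes p: "p \<in> bounded_shapes L" and nz: "0 < (\<Sum>i<L. p i)"
  shows "(\<Sum>q\<in>horizontal_strips p. if \<forall>i. q i \<le> 1 then (- 1) ^ (\<Sum>i<L. q i) else 0 :: rat) = 0"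
proof -
  have p': "\<And>i. p (Suc i) \<le> p i" "\<And>i. L \<le> i \<Longrightarrow> p i = 0"
    using p by (auto simp: bounded_shapes_def)
  have fin: "finite (horizontal_strips p)" by (rule finite_horizontal_strips[of L p, OF p'(2)])
  obtain h where h: "0 < p h" "p (Suc h) = 0" "h < L"
  proof -
    have "\<exists>i. p i = 0" using p'(2) by blast
    define m where "m = (LEAST i. p i = 0)"
    have "p m = 0" unfolding m_def by (rule LeastI_ex) fact
    moreover have "m \<noteq> 0"
    proof
      assume "m = 0"
      have "p i \<le> p 0" for i by (rule lift_Suc_antimono_le[of p]) (use p'(1) in auto)
      then show False using \<open>p m = 0\<close> \<open>m = 0\<close> nz by simp
    qed
    moreover have "0 < p (m - 1)"
      using not_less_Least[of "m - 1" "\<lambda>i. p i = 0"] \<open>m \<noteq> 0\<close> by (simp add: m_def)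
    ultimately show ?thesis using that[of "m - 1"] p'(2)[of "m - 1"] by force
  qed
  let ?C = "{q \<in> horizontal_strips p. \<forall>i. q i \<le> 1}"
  let ?t = "\<lambda>q :: nat \<Rightarrow> nat. q(h := 1 - q h)"
  \<comment> \<open>Row \<open>h\<close> of a remainder is confined between
    \<open>p (Suc h) = 0\<close> and \<open>p h > 0\<close>, so both 0 and 1 are admissible
    there.\<close>
  have t_mem: "?t q \<in> ?C" if "q \<in> ?C" for q
    using that h by (auto simp: horizontal_strips_def)
  have t_t: "?t (?t q) = q" if "q \<in> ?C" for q
    using that by (auto simp: fun_eq_iff le_Suc_eq)
  have sign: "(- 1) ^ (\<Sum>i<L. ?t q i) = - ((- 1) ^ (\<Sum>i<L. q i) :: rat)" if "q \<in> ?C" for q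
  proof -
    have "(\<Sum>i<L. f i) = f h + (\<Sum>i\<in>{..<L} - {h}. f i)" for f :: "nat \<Rightarrow> nat"
      using h(3) by (intro sum.remove) auto
    moreover have "q h = 0 \<or> q h = 1" using that by (auto simp: le_Suc_eq)
    moreover have "(\<Sum>i\<in>{..<L} - {h}. ?t q i) = (\<Sum>i\<in>{..<L} - {h}. q i)" by (intro sum.cong) auto
    ultimately show ?thesis by (auto simp: power_add)
  qed
  have "(\<Sum>q\<in>?C. (- 1) ^ (\<Sum>i<L. q i)) = (\<Sum>q\<in>?C. - ((- 1) ^ (\<Sum>i<L. q i) :: rat))"
    by (rule sum.reindex_bij_witness[where i = ?t and j = ?t]) (use t_mem t_t sign in \<open>auto simp del: fun_upd_apply\<close>)
  then have "(\<Sum>q\<in>?C. (- 1) ^ (\<Sum>i<L. q i)) = (0::rat)" by (simp add: sum_negf)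
  then show ?thesis using fin by (simp add: sum.If_cases Int_def)
qed

text \<open>Patterns are chains of horizontal strips. The identity is the expansion of an elementary
  symmetric function as a signed sum of products of complete homogeneous ones, paired with a Schur
  function.\<close>

lemma alternating_sum_gt_patterns:
  assumes p: "p \<in> bounded_shapes L"
  shows "(\<Sum>b\<in>compositions (\<Sum>i<L. p i). (- 1) ^ length b * of_nat (card (gt_patterns L p b))) =
    (if \<forall>i. p i \<le> 1 then (- 1) ^ (\<Sum>i<L. p i) else 0 :: rat)"
proof (rule alternating_chain_sum[where X = "bounded_shapes L" and sz = "\<lambda>p. \<Sum>i<L. p i" and Y = horizontal_strips and x = p])
  fix x assume x: "x \<in> bounded_shapes L"
  have zero: "x = (\<lambda>i. 0)" if "(\<Sum>i<L. x i) = 0"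
  proof
    show "x i = 0" for i using that x by (cases "i < L") (simp_all add: bounded_shapes_def)
  qed
  show "card (gt_patterns L x []) = 1" if "(\<Sum>i<L. x i) = 0"
    using zero[OF that] x by (simp add: gt_patterns_Nil)
  show "(if \<forall>i. x i \<le> 1 then (- 1) ^ (\<Sum>i<L. x i) else 0 :: rat) = 1" if "(\<Sum>i<L. x i) = 0"
    using zero[OF that] by simp
  show "finite (horizontal_strips x) \<and> horizontal_strips x \<subseteq> bounded_shapes L \<and> x \<in> horizontal_strips x"
    using x horizontal_strips_bounded_shapes[OF x] finite_horizontal_strips[of L x]
    by (auto simp: bounded_shapes_def horizontal_strips_def)
  show "(\<Sum>i<L. y i) < (\<Sum>i<L. x i)" if y: "y \<in> horizontal_strips x" and "y \<noteq> x" for y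
  proof -
    have le: "y i \<le> x i" for i using y by (simp add: horizontal_strips_def)
    obtain i where "y i \<noteq> x i" using \<open>y \<noteq> x\<close> by auto
    then have "y i < x i" using le[of i] by simp
    moreover from this have "i < L" using x by (cases "i < L") (simp_all add: bounded_shapes_def)
    ultimately show ?thesis using le by (intro sum_strict_mono_ex1) auto
  qed
qed (use p card_gt_patterns_snoc sum_columns_horizontal_strips in auto)

section \<open>Expansion in Schur functions\<close>

text \<open>Adjacent swaps bring the head of \<open>xs\<close> to the front of \<open>ys\<close>;
  the induction then applies to the tails with that head fixed.\<close>

lemma swap_invariant_mset:
  assumes "\<And>u a b v. f (u @ [a, b] @ v) = f (u @ [b, a] @ v)" "mset xs = mset ys"
  shows "f xs = f ys"
  using assms
proof (induction xs arbitrary: ys f)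
  case (Cons x xs)
  have move: "f (u @ x # v) = f (x # u @ v)" for u v
  proof (induction u arbitrary: v rule: rev_induct)
    case (snoc y u)
    then show ?case using Cons.prems(1)[of u y x v] by simp
  qed simp
  have "x \<in> set ys" using Cons.prems(2) by (metis list.set_intros(1) set_mset_mset)
  then obtain u v where ys: "ys = u @ x # v" by (meson split_list)
  have "f (x # xs) = f (x # u @ v)"
    by (rule Cons.IH[where f = "\<lambda>zs. f (x # zs)"])
      (use Cons.prems(1)[of "x # _"] Cons.prems(2) ys in auto)
  then show ?case using move ys by simp
qed simp

text \<open>Symmetry is demanded only for adjacent exponents, the form in which toggling and
  recoloring provide it.\<close>

definition symmetric_of_degree :: "nat \<Rightarrow> power_series \<Rightarrow> bool" where
  "symmetric_of_degree n F \<longleftrightarrow>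
     (\<forall>m. poly_mapping.lookup m 0 \<noteq> 0 \<longrightarrow> F m = 0) \<and>
     (\<forall>u a b v. F (list_monomial (u @ [a, b] @ v)) = F (list_monomial (u @ [b, a] @ v))) \<and>
     (\<forall>b. F (list_monomial b) \<noteq> 0 \<longrightarrow> sum_list b = n)"

definition partitions :: "nat \<Rightarrow> nat list set" where
  "partitions n = {l. is_partition l \<and> sum_list l = n}"

lemma finite_partitions: "finite (partitions n)"
  by (rule finite_subset[OF _ finite_compositions[of n]])
    (auto simp: partitions_def compositions_def is_partition_def)

lemma exists_partition_mset:
  fixes b :: "nat list"
  shows "\<exists>l z. is_partition l \<and> mset b = mset (l @ replicate z 0)"
proof (intro exI conjI)
  let ?l = "rev (sort (filter (\<lambda>x. \<not> 0 = x) b))"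
  show "is_partition ?l"
    by (auto simp: is_partition_def sorted_wrt_rev)
  show "mset b = mset (?l @ replicate (length (filter (\<lambda>x. 0 = x) b)) 0)"
    unfolding replicate_length_filter
    using multiset_partition[of "mset b" "\<lambda>x. 0 = x"] by (simp add: add.commute)
qed

text \<open>Exponents can be sorted decreasingly with the zeros at the end, where they do not affect
  the monomial; so the values at partitions determine the series.\<close>

lemma symmetric_of_degree_eqI:
  assumes F: "symmetric_of_degree n F" and G: "symmetric_of_degree n G"
    and eq: "\<And>l. l \<in> partitions n \<Longrightarrow> F (list_monomial l) = G (list_monomial l)"
  shows "F = G"
proof
  fix m
  show "F m = G m"
  proof (cases "poly_mapping.lookup m 0 = 0")
    case True
    then obtain b where b: "m = list_monomial b" using exists_list_monomial by blast
    obtain l z where l: "is_partition l" and mset: "mset b = mset (l @ replicate z 0)"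
      using exists_partition_mset by blast
    have to_partition: "H m = H (list_monomial l)" if "symmetric_of_degree n H" for H
    proof -
      have "H (list_monomial b) = H (list_monomial (l @ replicate z 0))"
        by (rule swap_invariant_mset[where f = "\<lambda>b. H (list_monomial b)", OF _ mset])
          (use that in \<open>auto simp: symmetric_of_degree_def\<close>)
      then show ?thesis by (simp add: b list_monomial_append_zeros)
    qed
    have "F (list_monomial l) = G (list_monomial l)"
    proof (cases "sum_list l = n")
      case True
      then show ?thesis using eq l by (simp add: partitions_def)
    next
      case False
      then show ?thesis using F G by (metis symmetric_of_degree_def)
    qed
    then show ?thesis using to_partition[OF F] to_partition[OF G] by simp
  next
    case False
    then show ?thesis using F G by (simp add: symmetric_of_degree_def)
  qed
qed

lemma symmetric_of_degree_0: "symmetric_of_degree n 0"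
  by (simp add: symmetric_of_degree_def)

lemma symmetric_of_degree_add:
  "symmetric_of_degree n F \<Longrightarrow> symmetric_of_degree n G \<Longrightarrow> symmetric_of_degree n (F + G)"
  unfolding symmetric_of_degree_def by (simp, metis add.right_neutral add.left_neutral)

lemma symmetric_of_degree_scale:
  "symmetric_of_degree n F \<Longrightarrow> symmetric_of_degree n (ps_scale c F)"
  by (simp add: symmetric_of_degree_def ps_scale_def)

lemma symmetric_of_degree_sum:
  assumes "\<And>x. x \<in> A \<Longrightarrow> symmetric_of_degree n (f x)"
  shows "symmetric_of_degree n (\<Sum>x\<in>A. f x)"
  using assms
  by (induction A rule: infinite_finite_induct) (simp_all add: symmetric_of_degree_0 symmetric_of_degree_add)

lemma symmetric_of_degree_schur:
  assumes l: "is_partition l"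
  shows "symmetric_of_degree (sum_list l) (schur l)"
  unfolding symmetric_of_degree_def
proof (intro conjI allI impI)
  fix m :: monomial assume m: "poly_mapping.lookup m 0 \<noteq> 0"
  have "{T \<in> ssyt l. monomial_of T (young_diagram l) = m} = {}"
  proof -
    have "poly_mapping.lookup (monomial_of T (young_diagram l)) 0 = 0" if "T \<in> ssyt l" for T
    proof -
      have "{c \<in> young_diagram l. T c = 0} = {}" using ssytD(1)[OF that] by fastforce
      then show ?thesis by (simp only: lookup_monomial_of[OF finite_young_diagram] card.empty)
    qed
    then show ?thesis using m by auto
  qed
  then show "schur l m = 0" by (simp only: schur_def card.empty of_nat_0)
next
  fix u a b v
  show "schur l (list_monomial (u @ [a, b] @ v)) = schur l (list_monomial (u @ [b, a] @ v))"
    using card_gt_patterns_swap[of "part l" "length l" u a b v] by (simp add: schur_list_monomial[OF l] part_def)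
next
  fix b assume "schur l (list_monomial b) \<noteq> 0"
  then show "sum_list b = sum_list l" using schur_nonzero_dominates[OF l] by (simp add: dominates_def)
qed

section \<open>Extracting Schur coefficients from monomial coefficients\<close>

lemma sum_power_series_apply:
  fixes f :: "'x \<Rightarrow> power_series"
  shows "(\<Sum>x\<in>A. f x) m = (\<Sum>x\<in>A. f x m)"
  by (induction A rule: infinite_finite_induct) auto

lemma dominates_antisym:
  "is_partition l \<Longrightarrow> is_partition m \<Longrightarrow> dominates l m \<Longrightarrow> dominates m l \<Longrightarrow> l = m"
  using dominance_rank_less[of l m] dominance_rank_less[of m l] by fastforce

text \<open>Unitriangularity is applied from the top down: the coefficients strictly above
  \<open>l\<close> vanish one after another, and then only \<open>schur l\<close> contributes to the
  monomial of \<open>l\<close>.\<close>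

lemma top_coefficient:
  assumes S: "finite S" "S \<subseteq> Collect is_partition" and F: "F = (\<Sum>l\<in>S. ps_scale (c l) (schur l))"
    and l: "l \<in> S"
    and vanish: "\<And>m. is_partition m \<Longrightarrow> dominates m l \<Longrightarrow> m \<noteq> l \<Longrightarrow> F (list_monomial m) = 0"
  shows "c l = F (list_monomial l)"
proof -
  have eval: "F (list_monomial m) = c m"
    if m: "m \<in> S" and above: "\<And>q. q \<in> S \<Longrightarrow> dominates q m \<Longrightarrow> q \<noteq> m \<Longrightarrow> c q = 0" for m
  proof -
    have "F (list_monomial m) = (\<Sum>q\<in>S. c q * schur q (list_monomial m))"
      by (simp add: F sum_power_series_apply ps_scale_def)
    also have "\<dots> = (\<Sum>q\<in>S. if q = m then c m else 0)"
    proof (rule sum.cong)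
      fix q assume q: "q \<in> S"
      then show "c q * schur q (list_monomial m) = (if q = m then c m else 0)"
        using S(2) above[OF q] schur_nonzero_dominates[of q m] schur_diagonal[of m] m by auto
    qed simp
    also have "\<dots> = c m" using m S(1) by simp
    finally show ?thesis .
  qed
  have zero: "c m = 0" if "m \<in> S" "dominates m l" "m \<noteq> l" for m
    using that
  \<comment> \<open>The finite set \<open>S\<close> has a largest rank, and moving up in dominance
    decreases the distance to it.\<close>
  proof (induction "Max (dominance_rank ` S) - dominance_rank m" arbitrary: m rule: less_induct)
    case less
    have "F (list_monomial m) = c m"
    proof (rule eval)
      fix q assume q: "q \<in> S" "dominates q m" "q \<noteq> m"
      have parts: "is_partition q" "is_partition m" "is_partition l" using q less.prems l S(2) by auto
      have rank: "dominance_rank m < dominance_rank q"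
        using dominance_rank_less parts q by blast
      have "dominance_rank q \<le> Max (dominance_rank ` S)" using q S(1) by simp
      moreover have "dominates q l" using dominates_trans q(2) less.prems(2) by blast
      moreover have "q \<noteq> l" using dominates_antisym parts q less.prems by blast
      ultimately show "c q = 0" using less.hyps[of q] rank q(1) by linarith
    qed (use less.prems in simp)
    then show ?case using vanish[of m] less.prems S(2) by auto
  qed
  show ?thesis using eval[OF l] zero by simp
qed

abbreviation schur_basis :: "power_series set" where
  "schur_basis \<equiv> schur ` Collect is_partition"

text \<open>\<open>schur_coeff\<close> looks up a series, not a partition; injectivity makes this
  lookup unambiguous.\<close>

lemma inj_on_schur: "inj_on schur (Collect is_partition)"
proof (rule inj_onI)
  fix l m assume "l \<in> Collect is_partition" "m \<in> Collect is_partition" and eq: "schur l = schur m"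
  then have parts: "is_partition l" "is_partition m" by auto
  have "dominates m l" using schur_nonzero_dominates[OF parts(2), of l] schur_diagonal[OF parts(1)] eq by simp
  moreover have "dominates l m" using schur_nonzero_dominates[OF parts(1), of m] schur_diagonal[OF parts(2)] eq by simp
  ultimately show "l = m" using dominates_antisym parts by blast
qed

text \<open>The zero series satisfies the vanishing hypothesis of \<open>top_coefficient\<close> at
  every partition, so all coefficients of a vanishing combination are 0.\<close>

lemma independent_schur: "ps.independent schur_basis"
  unfolding ps.dependent_explicit
proof safe
  fix t u v assume t: "finite t" "t \<subseteq> schur_basis" "(\<Sum>v\<in>t. ps_scale (u v) v) = 0" and v: "v \<in> t" "u v \<noteq> 0"
  obtain S where S: "S \<subseteq> Collect is_partition" "finite S" "t = schur ` S"
    using finite_subset_image[OF t(1,2)] by blast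
  have "inj_on schur S" using inj_on_schur S(1) by (rule inj_on_subset)
  then have "(0 :: power_series) = (\<Sum>l\<in>S. ps_scale (u (schur l)) (schur l))"
    using t(3) by (simp add: S(3) sum.reindex)
  from top_coefficient[OF S(2,1) this] have "u (schur l) = 0" if "l \<in> S" for l
    using that by simp
  then show False using v S(3) by auto
qed

lemma schur_expansion:
  assumes "F \<in> ps.span schur_basis"
  shows "\<exists>S. finite S \<and> S \<subseteq> Collect is_partition \<and>
    (\<forall>l. is_partition l \<longrightarrow> l \<notin> S \<longrightarrow> schur_coeff l F = 0) \<and>
    F = (\<Sum>l\<in>S. ps_scale (schur_coeff l F) (schur l))"
proof -
  let ?r = "ps.representation schur_basis F"
  let ?S = "{l. is_partition l \<and> ?r (schur l) \<noteq> 0}"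
  have img: "{b. ?r b \<noteq> 0} = schur ` ?S"
    using ps.representation_ne_zero[of schur_basis F] by force
  have inj: "inj_on schur ?S" using inj_on_schur by (rule inj_on_subset) auto
  have "finite ?S"
    using ps.finite_representation[of schur_basis F] finite_imageD[OF _ inj] img by simp
  moreover have "F = (\<Sum>l\<in>?S. ps_scale (schur_coeff l F) (schur l))"
  proof -
    have "F = (\<Sum>b | ?r b \<noteq> 0. ps_scale (?r b) b)"
      using ps.sum_nonzero_representation_eq[OF independent_schur assms] by simp
    also have "\<dots> = (\<Sum>l\<in>?S. ps_scale (schur_coeff l F) (schur l))"
      unfolding img by (simp add: sum.reindex[OF inj] schur_coeff_def)
    finally show ?thesis .
  qed
  ultimately show ?thesis by (intro exI[of _ ?S]) (auto simp: schur_coeff_def)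
qed

lemma schur_coeff_top:
  assumes F: "F \<in> ps.span schur_basis" and l: "is_partition l"
    and vanish: "\<And>m. is_partition m \<Longrightarrow> dominates m l \<Longrightarrow> m \<noteq> l \<Longrightarrow> F (list_monomial m) = 0"
  shows "schur_coeff l F = F (list_monomial l)"
proof -
  obtain S where S: "finite S" "S \<subseteq> Collect is_partition" "F = (\<Sum>l\<in>S. ps_scale (schur_coeff l F) (schur l))"
    and out: "\<And>l. is_partition l \<Longrightarrow> l \<notin> S \<Longrightarrow> schur_coeff l F = 0"
    using schur_expansion[OF F] by blast
  \<comment> \<open>If \<open>l\<close> is not in \<open>S\<close>, it is added with coefficient 0,
    so that \<open>top_coefficient\<close> covers this case too.\<close>
  have "F = (\<Sum>m\<in>insert l S. ps_scale (schur_coeff m F) (schur m))"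
    using S(1,3) out[OF l] by (cases "l \<in> S") (auto simp: insert_absorb)
  from top_coefficient[OF _ _ this _ vanish] show ?thesis using S l by auto
qed

text \<open>By linearity, a functional dual to \<open>schur l\<close> on the basis reads off its
  coefficient. It is applied to an alternating sum over compositions.\<close>

lemma schur_coeff_functional:
  assumes F: "F \<in> ps.span schur_basis" and l: "is_partition l"
    and dual: "\<And>m. is_partition m \<Longrightarrow> (\<Sum>b\<in>B. w b * schur m (list_monomial b)) = (if m = l then 1 else 0)"
  shows "schur_coeff l F = (\<Sum>b\<in>B. w b * F (list_monomial b))"
proof -
  obtain S where S: "finite S" "S \<subseteq> Collect is_partition" "F = (\<Sum>l\<in>S. ps_scale (schur_coeff l F) (schur l))"
    and out: "\<And>l. is_partition l \<Longrightarrow> l \<notin> S \<Longrightarrow> schur_coeff l F = 0"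
    using schur_expansion[OF F] by blast
  have F_eval: "F m = (\<Sum>q\<in>S. schur_coeff q F * schur q m)" for m
  proof -
    have "F m = (\<Sum>l\<in>S. ps_scale (schur_coeff l F) (schur l)) m"
      by (rule arg_cong[where f = "\<lambda>F. F m", OF S(3)])
    then show ?thesis by (simp add: sum_power_series_apply ps_scale_def)
  qed
  have "(\<Sum>b\<in>B. w b * F (list_monomial b)) =
      (\<Sum>b\<in>B. \<Sum>q\<in>S. schur_coeff q F * (w b * schur q (list_monomial b)))"
    by (subst F_eval) (simp add: sum_distrib_left mult.left_commute)
  also have "\<dots> = (\<Sum>q\<in>S. schur_coeff q F * (\<Sum>b\<in>B. w b * schur q (list_monomial b)))"
    by (subst sum.swap) (simp add: sum_distrib_left)
  also have "\<dots> = (\<Sum>q\<in>S. if q = l then schur_coeff l F else 0)"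
    using S(2) dual by (intro sum.cong) auto
  also have "\<dots> = schur_coeff l F" using S(1) out[OF l] by auto
  finally show ?thesis by simp
qed

text \<open>Leading terms are subtracted rank by rank from the top, until all coefficients at
  partitions vanish.\<close>

lemma symmetric_in_span_schur:
  assumes "symmetric_of_degree n F"
  shows "F \<in> ps.span schur_basis"
proof -
  \<comment> \<open>Induction on a strict upper bound \<open>d\<close> for the ranks of the
    partitions that still occur in \<open>F\<close>.\<close>
  have "F \<in> ps.span schur_basis"
    if "symmetric_of_degree n F" "\<And>m. m \<in> partitions n \<Longrightarrow> d \<le> dominance_rank m \<Longrightarrow> F (list_monomial m) = 0" for d F
    using that
  proof (induction d arbitrary: F)
    case 0
    then have "F = 0"
      by (intro symmetric_of_degree_eqI[where n = n]) (auto simp: symmetric_of_degree_0)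
    then show ?case using ps.span_zero by (simp only:)
  next
    case (Suc d)
    let ?S = "{l \<in> partitions n. dominance_rank l = d}"
    let ?G = "\<Sum>l\<in>?S. ps_scale (F (list_monomial l)) (schur l)"
    have fin: "finite ?S" using finite_partitions by simp
    have G: "?G \<in> ps.span schur_basis"
      by (intro ps.span_sum ps.span_scale ps.span_base) (auto simp: partitions_def)
    have "symmetric_of_degree n ?G"
      by (intro symmetric_of_degree_sum symmetric_of_degree_scale)
        (use symmetric_of_degree_schur in \<open>auto simp: partitions_def\<close>)
    then have "symmetric_of_degree n (F + ps_scale (- 1) ?G)"
      using Suc.prems(1) symmetric_of_degree_add symmetric_of_degree_scale by blast
    then have "F + ps_scale (- 1) ?G \<in> ps.span schur_basis"
    proof (rule Suc.IH)
      fix m assume m: "m \<in> partitions n" "d \<le> dominance_rank m"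
      have "?G (list_monomial m) = (\<Sum>l\<in>?S. F (list_monomial l) * schur l (list_monomial m))"
        by (simp add: sum_power_series_apply ps_scale_def)
      also have "\<dots> = (\<Sum>l\<in>?S. if l = m then F (list_monomial m) else 0)"
      proof (rule sum.cong)
        fix l assume l: "l \<in> ?S"
        then have parts: "is_partition l" "is_partition m" using m by (auto simp: partitions_def)
        \<comment> \<open>Among partitions of rank at least \<open>d\<close>, a Schur function of
          rank \<open>d\<close> meets only its own.\<close>
        have "schur l (list_monomial m) = 0" if "l \<noteq> m"
          using schur_nonzero_dominates[OF parts(1), of m] dominance_rank_less[OF parts _ that] l m(2) by fastforce
        then show "F (list_monomial l) * schur l (list_monomial m) = (if l = m then F (list_monomial m) else 0)"
          using schur_diagonal[OF parts(1)] by auto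
      qed simp
      also have "\<dots> = F (list_monomial m)"
        using fin m Suc.prems(2)[of m] by auto
      finally show "(F + ps_scale (- 1) ?G) (list_monomial m) = 0"
        by (simp add: ps_scale_def)
    qed
    then have "F + ps_scale (- 1) ?G + ?G \<in> ps.span schur_basis" using G by (rule ps.span_add)
    then show ?case by simp
  qed
  note * = this
  show ?thesis
  \<comment> \<open>This bound exceeds every rank, so no partition satisfies the premise.\<close>
  proof (rule *[OF assms, of "Suc (Max (dominance_rank ` partitions n))"])
    fix m assume "m \<in> partitions n" "Suc (Max (dominance_rank ` partitions n)) \<le> dominance_rank m"
    then show "F (list_monomial m) = 0"
      using Max_ge[OF finite_imageI[OF finite_partitions], of "dominance_rank m" dominance_rank n] by fastforce
  qed
qed

section \<open>The coefficient of a column\<close>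

lemma part_le_1_iff:
  assumes "is_partition l"
  shows "(\<forall>i. part l i \<le> 1) \<longleftrightarrow> l = replicate (sum_list l) 1"
proof
  assume le: "\<forall>i. part l i \<le> 1"
  have "l = replicate (length l) 1"
  proof (rule nth_equalityI)
    fix i assume i: "i < length l"
    then have "0 < l ! i" using assms by (simp add: is_partition_def)
    moreover have "l ! i \<le> 1" using le[rule_format, of i] i by (simp add: part_def)
    ultimately show "l ! i = replicate (length l) 1 ! i" using i by simp
  qed simp
  moreover have "sum_list (replicate (length l) (1::nat)) = length l" by (simp add: sum_list_replicate)
  ultimately show "l = replicate (sum_list l) 1" by simp
next
  assume *: "l = replicate (sum_list l) 1"
  have "part (replicate k 1) i \<le> 1" for k i by (simp add: part_def)
  then show "\<forall>i. part l i \<le> 1" by (subst *) blast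
qed

text \<open>The signed sum over compositions is dual to the column: other shapes of size
  \<open>n\<close> are annihilated by \<open>alternating_sum_gt_patterns\<close>, and shapes of
  other sizes by degree.\<close>

lemma schur_coeff_column:
  assumes F: "F \<in> ps.span schur_basis"
  shows "schur_coeff (replicate n 1) F =
    (- 1) ^ n * (\<Sum>b\<in>compositions n. (- 1) ^ length b * F (list_monomial b))"
proof -
  have "schur_coeff (replicate n 1) F =
      (\<Sum>b\<in>compositions n. ((- 1) ^ n * (- 1) ^ length b) * F (list_monomial b))"
  proof (rule schur_coeff_functional[OF F])
    show "is_partition (replicate n 1)" by (simp add: is_partition_def sorted_wrt_iff_nth_less)
    fix m assume m: "is_partition m"
    show "(\<Sum>b\<in>compositions n. ((- 1) ^ n * (- 1) ^ length b) * schur m (list_monomial b)) =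
        (if m = replicate n 1 then 1 else 0)"
    proof (cases "sum_list m = n")
      case True
      have shape: "part m \<in> bounded_shapes (length m)"
        using part_antimono[OF m] by (auto simp: bounded_shapes_def part_def)
      have n: "(\<Sum>i<length m. part m i) = n" by (simp add: sum_part True)
      have "(\<Sum>b\<in>compositions n. (- 1) ^ length b * schur m (list_monomial b)) =
          (if \<forall>i. part m i \<le> 1 then (- 1) ^ n else 0)"
        using alternating_sum_gt_patterns[OF shape] unfolding n by (simp add: schur_list_monomial[OF m])
      then show ?thesis
        using part_le_1_iff[OF m] True
        by (simp add: mult.assoc flip: sum_distrib_left power_mult_distrib)
    next
      case False
      have "schur m (list_monomial b) = 0" if "b \<in> compositions n" for b
        using symmetric_of_degree_schur[OF m] that False
        by (auto simp: symmetric_of_degree_def compositions_def)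
      moreover have "m \<noteq> replicate n 1" using False by (auto simp: sum_list_replicate)
      ultimately show ?thesis by simp
    qed
  qed
  then show ?thesis by (simp add: sum_distrib_left mult.assoc)
qed

section \<open>Colorings and acyclic orientations\<close>

text \<open>Edges and vertices are separate arguments so that induced subgraphs arise by shrinking
  the vertex set alone.\<close>

definition stable :: "('a \<times> 'a) set \<Rightarrow> 'a set \<Rightarrow> bool" where
  "stable E S \<longleftrightarrow> (\<forall>u\<in>S. \<forall>v\<in>S. (u, v) \<notin> E)"

definition colorings :: "('a \<times> 'a) set \<Rightarrow> 'a set \<Rightarrow> nat list \<Rightarrow> ('a \<Rightarrow> nat) set" where
  "colorings E V b = {\<kappa> \<in> V \<rightarrow>\<^sub>E {1..}. (\<forall>u\<in>V. \<forall>v\<in>V. (u, v) \<in> E \<longrightarrow> \<kappa> u \<noteq> \<kappa> v) \<and>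
     monomial_of \<kappa> V = list_monomial b}"

lemma coloringsD:
  assumes "\<kappa> \<in> colorings E V b"
  shows "\<kappa> \<in> V \<rightarrow>\<^sub>E {1..}" and "u \<in> V \<Longrightarrow> v \<in> V \<Longrightarrow> (u, v) \<in> E \<Longrightarrow> \<kappa> u \<noteq> \<kappa> v"
    and "monomial_of \<kappa> V = list_monomial b"
  using assms by (auto simp: colorings_def)

lemma colorings_card_le:
  assumes "finite V" "\<kappa> \<in> colorings E V b"
  shows "card {v \<in> V. \<kappa> v \<le> k} = sum_list (take k b)"
  using coloringsD(3)[OF assms(2)] by (simp add: monomial_of_eq_list_monomial_iff[OF assms(1)])

lemma colorings_le_length:
  assumes "finite V" "\<kappa> \<in> colorings E V b" "v \<in> V"
  shows "\<kappa> v \<le> length b"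
  using monomial_of_eq_list_monomialD(2)[OF assms(1) coloringsD(3)[OF assms(2)] assms(3)] .

lemma finite_colorings:
  assumes "finite V"
  shows "finite (colorings E V b)"
proof (rule finite_subset)
  show "colorings E V b \<subseteq> V \<rightarrow>\<^sub>E {..length b}"
    using colorings_le_length[OF assms, where b = b] by (auto simp: PiE_iff dest: coloringsD(1))
qed (simp add: finite_PiE assms)

lemma colorings_card:
  assumes "finite V" "\<kappa> \<in> colorings E V b"
  shows "card V = sum_list b"
proof -
  have "{v \<in> V. \<kappa> v \<le> length b} = V" using colorings_le_length[OF assms] by auto
  then show ?thesis using colorings_card_le[OF assms, of "length b"] by simp
qed

text \<open>The last color class is a stable set of size \<open>c\<close>, and the other vertices
  keep their colors; this is the analogue of removing the last weight of a pattern.\<close>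

lemma colorings_snoc:
  fixes V :: "'a set"
  assumes V: "finite V"
  shows "bij_betw (\<lambda>\<kappa>. ({v \<in> V. \<kappa> v \<le> length b}, restrict \<kappa> {v \<in> V. \<kappa> v \<le> length b}))
    (colorings E V (b @ [c]))
    (SIGMA U:{U. U \<subseteq> V \<and> stable E (V - U) \<and> card U + c = card V}. colorings E U b)"
    (is "bij_betw ?f ?A ?B")
proof (rule bij_betw_byWitness[where f' = "\<lambda>(U, \<kappa>). restrict (\<lambda>v. if v \<in> U then \<kappa> v else Suc (length b)) V"])
  let ?g = "\<lambda>(U, \<kappa>). restrict (\<lambda>v. if v \<in> U then \<kappa> v else Suc (length b)) V"
  have last: "\<kappa> v = Suc (length b)" if "\<kappa> \<in> ?A" "v \<in> V" "\<not> \<kappa> v \<le> length b" for \<kappa> v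
    using colorings_le_length[OF V that(1,2)] that(3) by simp
  show "\<forall>\<kappa>\<in>?A. ?g (?f \<kappa>) = \<kappa>"
  proof (intro ballI ext)
    fix \<kappa> v assume \<kappa>: "\<kappa> \<in> ?A"
    show "?g (?f \<kappa>) v = \<kappa> v"
      using last[OF \<kappa>, of v] PiE_arb[OF coloringsD(1)[OF \<kappa>], of v] by auto
  qed
  show "\<forall>x\<in>?B. ?f (?g x) = x"
  proof
    fix x assume "x \<in> ?B"
    then obtain U \<kappa> where x: "x = (U, \<kappa>)" and U: "U \<subseteq> V" and \<kappa>: "\<kappa> \<in> colorings E U b" by auto
    have "finite U" using U V by (rule finite_subset)
    have "{v \<in> V. ?g x v \<le> length b} = U"
      using U colorings_le_length[OF \<open>finite U\<close> \<kappa>] by (auto simp: x split: if_splits)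
    moreover have "restrict (?g x) U = \<kappa>"
    proof
      show "restrict (?g x) U v = \<kappa> v" for v
        using U PiE_arb[OF coloringsD(1)[OF \<kappa>], of v] by (cases "v \<in> U") (auto simp: x)
    qed
    ultimately show "?f (?g x) = x" by (simp add: x)
  qed
  show "?f ` ?A \<subseteq> ?B"
  proof
    fix x assume "x \<in> ?f ` ?A"
    then obtain \<kappa> where x: "x = ?f \<kappa>" and \<kappa>: "\<kappa> \<in> ?A" by blast
    let ?U = "{v \<in> V. \<kappa> v \<le> length b}"
    have "finite ?U" using V by simp
    have "stable E (V - ?U)"
      unfolding stable_def
    proof (intro ballI)
      fix u v assume "u \<in> V - ?U" "v \<in> V - ?U"
      then show "(u, v) \<notin> E" using last[OF \<kappa>, of u] last[OF \<kappa>, of v] coloringsD(2)[OF \<kappa>, of u v] by auto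
    qed
    moreover have "card ?U + c = card V"
      using colorings_card_le[OF V \<kappa>, of "length b"] colorings_card[OF V \<kappa>] by simp
    moreover have "restrict \<kappa> ?U \<in> colorings E ?U b"
      unfolding colorings_def monomial_of_eq_list_monomial_iff[OF \<open>finite ?U\<close>]
    proof (intro CollectI conjI allI ballI impI)
      show "restrict \<kappa> ?U \<in> ?U \<rightarrow>\<^sub>E {1..}" using coloringsD(1)[OF \<kappa>] by (auto simp: PiE_iff)
      show "restrict \<kappa> ?U u \<noteq> restrict \<kappa> ?U v" if "u \<in> ?U" "v \<in> ?U" "(u, v) \<in> E" for u v
        using that coloringsD(2)[OF \<kappa>, of u v] by simp
      fix k
      have "{v \<in> ?U. restrict \<kappa> ?U v \<le> k} = {v \<in> V. \<kappa> v \<le> min k (length b)}" by auto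
      then show "card {v \<in> ?U. restrict \<kappa> ?U v \<le> k} = sum_list (take k b)"
        using colorings_card_le[OF V \<kappa>, of "min k (length b)"] by (simp add: min_def split: if_splits)
    qed
    ultimately show "x \<in> ?B" unfolding x by blast
  qed
  show "?g ` ?B \<subseteq> ?A"
  proof
    fix \<kappa>' assume "\<kappa>' \<in> ?g ` ?B"
    then obtain U \<kappa> where \<kappa>': "\<kappa>' = ?g (U, \<kappa>)" and U: "U \<subseteq> V" "stable E (V - U)" "card U + c = card V"
      and \<kappa>: "\<kappa> \<in> colorings E U b" by auto
    have "finite U" using U V by (auto intro: finite_subset)
    note le = colorings_le_length[OF \<open>finite U\<close> \<kappa>]
    show "\<kappa>' \<in> ?A"
      unfolding colorings_def monomial_of_eq_list_monomial_iff[OF V]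
    proof (intro CollectI conjI allI ballI impI)
      show "\<kappa>' \<in> V \<rightarrow>\<^sub>E {1..}" using coloringsD(1)[OF \<kappa>] by (auto simp: \<kappa>' PiE_iff)
      show "\<kappa>' u \<noteq> \<kappa>' v" if "u \<in> V" "v \<in> V" "(u, v) \<in> E" for u v
        using that coloringsD(2)[OF \<kappa>, of u v] U(2) le[of u] le[of v]
        by (auto simp: \<kappa>' stable_def)
      fix k
      show "card {v \<in> V. \<kappa>' v \<le> k} = sum_list (take k (b @ [c]))"
      proof (cases "k \<le> length b")
        case True
        then have "{v \<in> V. \<kappa>' v \<le> k} = {v \<in> U. \<kappa> v \<le> k}" using U(1) by (auto simp: \<kappa>')
        then show ?thesis using colorings_card_le[OF \<open>finite U\<close> \<kappa>, of k] True by simp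
      next
        case False
        then have "{v \<in> V. \<kappa>' v \<le> k} = V" using le by (fastforce simp: \<kappa>')
        then show ?thesis using colorings_card[OF \<open>finite U\<close> \<kappa>] U(3) False by (simp add: take_Cons')
      qed
    qed
  qed
qed

text \<open>For finite \<open>V\<close>, well-foundedness of \<open>R\<close> amounts to
  acyclicity.\<close>

definition orientations :: "('a \<times> 'a) set \<Rightarrow> 'a set \<Rightarrow> ('a \<times> 'a) set set" where
  "orientations E V = {R. R \<subseteq> E \<inter> V \<times> V \<and>
     (\<forall>u\<in>V. \<forall>v\<in>V. (u, v) \<in> E \<longrightarrow> ((u, v) \<in> R \<longleftrightarrow> (v, u) \<notin> R)) \<and> wf R}"

lemma finite_orientations: "finite V \<Longrightarrow> finite (orientations E V)"
  by (rule finite_subset[of _ "Pow (V \<times> V)"]) (auto simp: orientations_def)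

text \<open>Number the vertices injectively and direct each edge towards the larger number.\<close>

lemma orientations_nonempty:
  assumes "finite V" "irrefl E" "sym E"
  shows "orientations E V \<noteq> {}"
proof -
  obtain f :: "'a \<Rightarrow> nat" where f: "inj_on f V"
    using finite_imp_inj_to_nat_seg[OF assms(1)] by blast
  have "{(u, v) \<in> E \<inter> V \<times> V. f u < f v} \<in> orientations E V"
    unfolding orientations_def
  proof (intro CollectI conjI ballI impI)
    show "wf {(u, v) \<in> E \<inter> V \<times> V. f u < f v}"
      by (rule wf_subset[OF wf_measure[of f]]) auto
    fix u v assume uv: "u \<in> V" "v \<in> V" "(u, v) \<in> E"
    then have "u \<noteq> v" using assms(2) by (auto simp: irrefl_def)
    then have "f u \<noteq> f v" using f uv by (auto simp: inj_on_def)
    moreover have "(v, u) \<in> E" using assms(3) uv(3) by (rule symD)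
    ultimately show "(u, v) \<in> {(u, v) \<in> E \<inter> V \<times> V. f u < f v} \<longleftrightarrow> (v, u) \<notin> {(u, v) \<in> E \<inter> V \<times> V. f u < f v}"
      using uv by auto
  qed auto
  then show ?thesis by blast
qed

definition sources :: "('a \<times> 'a) set \<Rightarrow> 'a set \<Rightarrow> 'a set" where
  "sources R V = {v \<in> V. \<forall>u. (u, v) \<notin> R}"

text \<open>If \<open>S\<close> consists of sources, every edge between \<open>S\<close> and the
  rest is directed out of \<open>S\<close>, and no edge lies inside \<open>S\<close>; the only
  freedom is the orientation of the rest.\<close>

lemma card_orientations_minus:
  assumes "sym E" "S \<subseteq> V" "stable E S"
  shows "card (orientations E (V - S)) = card {R \<in> orientations E V. S \<subseteq> sources R V}"
proof (rule bij_betw_same_card[symmetric])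
  let ?W = "V - S"
  let ?B = "E \<inter> S \<times> ?W"
  show "bij_betw (\<lambda>R. R \<inter> ?W \<times> ?W) {R \<in> orientations E V. S \<subseteq> sources R V} (orientations E ?W)"
  proof (rule bij_betw_byWitness[where f' = "\<lambda>R. ?B \<union> R"])
    show "\<forall>R\<in>{R \<in> orientations E V. S \<subseteq> sources R V}. ?B \<union> R \<inter> ?W \<times> ?W = R"
      using assms(2) by (auto simp: orientations_def sources_def)
    show "\<forall>R\<in>orientations E ?W. (?B \<union> R) \<inter> ?W \<times> ?W = R"
      by (auto simp: orientations_def)
    show "(\<lambda>R. R \<inter> ?W \<times> ?W) ` {R \<in> orientations E V. S \<subseteq> sources R V} \<subseteq> orientations E ?W"
      by (auto simp: orientations_def intro: wf_subset)
    show "(\<lambda>R. ?B \<union> R) ` orientations E ?W \<subseteq> {R \<in> orientations E V. S \<subseteq> sources R V}"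
    proof safe
      fix R assume R: "R \<in> orientations E ?W"
      have "wf ?B"
        by (rule wf_subset[OF wf_measure[of "\<lambda>v. if v \<in> S then 0 else 1"]]) auto
      \<comment> \<open>Arcs of \<open>?B\<close> start in \<open>S\<close>, where no arc of
        \<open>R\<close> ends, so the union creates no cycle.\<close>
      then have "wf (?B \<union> R)"
        by (rule wf_Un) (use R in \<open>auto simp: orientations_def\<close>)
      moreover have "(u, v) \<in> ?B \<union> R \<longleftrightarrow> (v, u) \<notin> ?B \<union> R" if "u \<in> V" "v \<in> V" "(u, v) \<in> E" for u v
      proof (cases "u \<in> S \<or> v \<in> S")
        case True
        have "R \<subseteq> ?W \<times> ?W" using R by (auto simp: orientations_def)
        moreover have "\<not> (u \<in> S \<and> v \<in> S)" using assms(3) that(3) by (auto simp: stable_def)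
        moreover have "(v, u) \<in> E" using assms(1) that(3) by (rule symD)
        ultimately show ?thesis using True that by blast
      next
        case False
        then have "u \<in> ?W" "v \<in> ?W" using that by auto
        then have "(u, v) \<in> R \<longleftrightarrow> (v, u) \<notin> R" using R that(3) by (simp add: orientations_def)
        then show ?thesis using False by simp
      qed
      ultimately show "?B \<union> R \<in> orientations E V"
        using R assms(2) by (auto simp: orientations_def)
      show "v \<in> sources (?B \<union> R) V" if "v \<in> S" for v
        using that R assms(2) by (auto simp: sources_def orientations_def)
    qed
  qed
qed

text \<open>Toggling membership of one fixed element reverses the sign.\<close>

lemma sum_Pow_alternating:
  assumes "finite A" "A \<noteq> {}"
  shows "(\<Sum>S\<in>Pow A. (- 1) ^ card S) = (0 :: rat)"
proof -
  obtain a where a: "a \<in> A" using assms(2) by blast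
  let ?t = "\<lambda>S. if a \<in> S then S - {a} else insert a S"
  have "(\<Sum>S\<in>Pow A. (- 1) ^ card S) = (\<Sum>S\<in>Pow A. - ((- 1) ^ card S :: rat))"
  proof (rule sum.reindex_bij_witness[where i = ?t and j = ?t])
    fix S assume "S \<in> Pow A"
    then have "finite S" using assms(1) finite_subset by blast
    then have "card (?t S) = Suc (card S) \<or> card S = Suc (card (?t S))"
      using card_Suc_Diff1[of S a] by auto
    then show "- ((- 1) ^ card (?t S)) = ((- 1) ^ card S :: rat)"
      by (elim disjE) (simp_all only: power_Suc mult_minus1 minus_minus)
  qed (use a in auto)
  then show ?thesis by (simp add: sum_negf)
qed

lemma sources_nonempty:
  assumes "R \<in> orientations E V" "V \<noteq> {}"
  shows "sources R V \<noteq> {}"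
proof -
  obtain v where "v \<in> V" "\<And>u. (u, v) \<in> R \<Longrightarrow> u \<notin> V"
    using assms wfE_min'[of R V] by (auto simp: orientations_def)
  then show ?thesis using assms(1) by (auto simp: sources_def orientations_def)
qed

text \<open>Double counting: an acyclic orientation outside a stable set \<open>S\<close> is one of
  \<open>V\<close> with \<open>S\<close> among its sources. For each orientation of \<open>V\<close>
  the subsets of its nonempty source set cancel.\<close>

lemma sum_orientations_stable:
  assumes V: "finite V" "V \<noteq> {}" and E: "sym E"
  shows "(\<Sum>U | U \<subseteq> V \<and> stable E (V - U). (- 1) ^ card U * of_nat (card (orientations E U))) = (0 :: rat)"
proof -
  let ?O = "orientations E V"
  let ?St = "{S. S \<subseteq> V \<and> stable E S}"
  have finO: "finite ?O" and finSt: "finite ?St"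
    using V finite_orientations by (auto intro: finite_subset[of _ "Pow V"])
  have "(\<Sum>U | U \<subseteq> V \<and> stable E (V - U). (- 1) ^ card U * of_nat (card (orientations E U)))
      = (\<Sum>S\<in>?St. (- 1) ^ card (V - S) * of_nat (card (orientations E (V - S))) :: rat)"
    by (rule sum.reindex_bij_witness[where i = "\<lambda>S. V - S" and j = "\<lambda>S. V - S"])
      (auto simp: double_diff)
  also have "\<dots> = (\<Sum>S\<in>?St. \<Sum>R\<in>?O. if S \<subseteq> sources R V then (- 1) ^ card V * (- 1) ^ card S else 0)"
  proof (rule sum.cong)
    fix S assume S: "S \<in> ?St"
    then have "finite S" using V finite_subset by blast
    then have "card V = card (V - S) + card S"
      using S V card_Diff_subset[of S V] card_mono[of V S] by simp
    then have "(- 1) ^ card (V - S) = ((- 1) ^ card V * (- 1) ^ card S :: rat)"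
      by (simp add: power_add mult.assoc flip: power_mult_distrib)
    moreover have "card (orientations E (V - S)) = card (?O \<inter> {R. S \<subseteq> sources R V})"
      using card_orientations_minus[OF E, of S V] S by (simp add: Int_def)
    ultimately show "(- 1) ^ card (V - S) * of_nat (card (orientations E (V - S))) =
        (\<Sum>R\<in>?O. if S \<subseteq> sources R V then (- 1) ^ card V * (- 1) ^ card S else 0 :: rat)"
      using finO by (simp add: sum.If_cases)
  qed simp
  also have "\<dots> = (\<Sum>R\<in>?O. \<Sum>S\<in>?St. if S \<subseteq> sources R V then (- 1) ^ card V * (- 1) ^ card S else 0)"
    by (rule sum.swap)
  also have "\<dots> = (\<Sum>R\<in>?O. 0)"
  proof (rule sum.cong)
    fix R assume R: "R \<in> ?O"
    \<comment> \<open>An edge between two sources would be an arc into one of them. Hence the stable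
      sets inside the source set are all of its subsets.\<close>
    have "stable E (sources R V)"
      using R by (fastforce simp: sources_def stable_def orientations_def)
    then have src: "?St \<inter> {S. S \<subseteq> sources R V} = Pow (sources R V)"
      by (auto simp: stable_def sources_def)
    have "finite (sources R V)" using V by (simp add: sources_def)
    then have "(\<Sum>S\<in>Pow (sources R V). (- 1) ^ card S) = (0 :: rat)"
      using sources_nonempty[OF R V(2)] by (rule sum_Pow_alternating)
    then show "(\<Sum>S\<in>?St. if S \<subseteq> sources R V then (- 1) ^ card V * (- 1) ^ card S else 0) = (0 :: rat)"
      using finSt by (simp add: sum.If_cases src flip: sum_distrib_left)
  qed simp
  finally show ?thesis by simp
qed

text \<open>This is Stanley's theorem that the chromatic polynomial at \<open>- 1\<close> counts acyclic orientations.\<close>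

lemma alternating_sum_colorings:
  assumes V: "finite V" and E: "sym E"
  shows "(\<Sum>b\<in>compositions (card V). (- 1) ^ length b * of_nat (card (colorings E V b))) =
    ((- 1) ^ card V * of_nat (card (orientations E V)) :: rat)"
proof (rule alternating_chain_sum[where X = "Pow V" and sz = card and Y = "\<lambda>V. {U. U \<subseteq> V \<and> stable E (V - U)}" and x = V])
  fix W assume "W \<in> Pow V"
  then have W: "finite W" using V finite_subset by auto
  show "card (colorings E W []) = 1" if "card W = 0"
  proof -
    have "colorings E W [] = {\<lambda>v. undefined}"
      using that W by (auto simp: colorings_def monomial_of_def list_monomial_def)
    then show ?thesis by simp
  qed
  show "(- 1) ^ card W * of_nat (card (orientations E W)) = (1::rat)" if "card W = 0"
  proof -
    have "orientations E W = {{}}" using that W by (auto simp: orientations_def)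
    then show ?thesis using that by simp
  qed
  show "card (colorings E W (b @ [c])) =
      (\<Sum>U | U \<in> {U. U \<subseteq> W \<and> stable E (W - U)} \<and> card U + c = card W. card (colorings E U b))" for b c
  proof -
    have "finite {U. U \<subseteq> W \<and> stable E (W - U) \<and> card U + c = card W}"
      using W by (auto intro: finite_subset[of _ "Pow W"])
    moreover have "finite (colorings E U b)" if "U \<subseteq> W" for U
      using finite_colorings finite_subset[OF that W] by blast
    ultimately show ?thesis
      using bij_betw_same_card[OF colorings_snoc[OF W, of b E c]] by (simp add: card_SigmaI conj_assoc)
  qed
  show "finite {U. U \<subseteq> W \<and> stable E (W - U)} \<and> {U. U \<subseteq> W \<and> stable E (W - U)} \<subseteq> Pow V
      \<and> W \<in> {U. U \<subseteq> W \<and> stable E (W - U)}"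
    using W \<open>W \<in> Pow V\<close> by (auto simp: stable_def intro: finite_subset[of _ "Pow W"])
  show "card U < card W" if "U \<in> {U. U \<subseteq> W \<and> stable E (W - U)}" "U \<noteq> W" for U
    using that W by (auto intro: psubset_card_mono)
  show "(\<Sum>U | U \<subseteq> W \<and> stable E (W - U). (- 1) ^ card U * of_nat (card (orientations E U))) = (0 :: rat)"
    if "0 < card W"
    using that W E by (intro sum_orientations_stable) auto
qed simp

section \<open>Chromatic symmetric functions\<close>

lemma chromatic_sym_list_monomial:
  assumes "pair_graph G"
  shows "chromatic_sym G (list_monomial b) = of_nat (card (colorings (parcs G) (pverts G) b))"
proof -
  interpret pair_graph G by fact
  have "{\<kappa> \<in> proper_colorings G. monomial_of \<kappa> (pverts G) = list_monomial b} = colorings (parcs G) (pverts G) b"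
    using in_arcsD1 in_arcsD2 by (fastforce simp: colorings_def proper_colorings_def)
  then show ?thesis by (simp add: chromatic_sym_def)
qed

lemma recolor_mem:
  assumes V: "finite V" and \<kappa>: "\<kappa> \<in> colorings E V (u @ [a, b] @ v)"
  shows "restrict (\<lambda>x. transpose (Suc (length u)) (Suc (Suc (length u))) (\<kappa> x)) V \<in> colorings E V (u @ [b, a] @ v)"
proof -
  \<comment> \<open>Colors count from 1 and list positions from 0, so \<open>a\<close> and
    \<open>b\<close> are the multiplicities of exactly these two colors.\<close>
  let ?t = "transpose (Suc (length u)) (Suc (Suc (length u)))"
  let ?\<kappa> = "restrict (\<lambda>x. ?t (\<kappa> x)) V"
  have "monomial_of ?\<kappa> V = list_monomial (u @ [b, a] @ v)"
  proof (rule poly_mapping_eqI)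
    fix k
    have "{x \<in> V. ?\<kappa> x = k} = {x \<in> V. \<kappa> x = ?t k}" by auto
    then have "poly_mapping.lookup (monomial_of ?\<kappa> V) k = poly_mapping.lookup (monomial_of \<kappa> V) (?t k)"
      by (simp add: lookup_monomial_of[OF V])
    also have "\<dots> = poly_mapping.lookup (list_monomial (u @ [a, b] @ v)) (?t k)"
      using coloringsD(3)[OF \<kappa>] by simp
    also have "\<dots> = poly_mapping.lookup (list_monomial (u @ [b, a] @ v)) k"
    proof -
      consider "k = Suc (length u)" | "k = Suc (Suc (length u))" | "k \<noteq> Suc (length u)" "k \<noteq> Suc (Suc (length u))" by blast
      then show ?thesis
      proof cases
        case 3
        then have "k \<le> length u \<or> (\<exists>j. k = j + length u + 3)" by presburger
        then show ?thesis using 3 by (auto simp: lookup_list_monomial nth_append)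
      qed (auto simp: lookup_list_monomial nth_append)
    qed
    finally show "poly_mapping.lookup (monomial_of ?\<kappa> V) k = poly_mapping.lookup (list_monomial (u @ [b, a] @ v)) k" .
  qed
  moreover have "1 \<le> ?t k" if "1 \<le> k" for k using that by (auto simp: transpose_def)
  ultimately show ?thesis
    using coloringsD(1,2)[OF \<kappa>] by (auto simp: colorings_def PiE_iff dest: injD[OF inj_transpose])
qed

lemma symmetric_of_degree_chromatic:
  assumes G: "pair_graph G"
  shows "symmetric_of_degree (card (pverts G)) (chromatic_sym G)"
  unfolding symmetric_of_degree_def
proof (intro conjI allI impI)
  interpret pair_graph G by fact
  have V: "finite (pverts G)" by simp
  {
    fix m :: monomial assume m: "poly_mapping.lookup m 0 \<noteq> 0"
    have "monomial_of \<kappa> (pverts G) \<noteq> m" if "\<kappa> \<in> proper_colorings G" for \<kappa>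
    proof -
      have "{v \<in> pverts G. \<kappa> v = 0} = {}" using that by (fastforce simp: proper_colorings_def PiE_iff)
      then have "poly_mapping.lookup (monomial_of \<kappa> (pverts G)) 0 = 0"
        by (simp only: lookup_monomial_of[OF V] card.empty)
      then show ?thesis using m by auto
    qed
    then have "{\<kappa> \<in> proper_colorings G. monomial_of \<kappa> (pverts G) = m} = {}" by blast
    then show "chromatic_sym G m = 0" by (simp only: chromatic_sym_def card.empty of_nat_0)
  }
  show "chromatic_sym G (list_monomial (u @ [a, b] @ v)) = chromatic_sym G (list_monomial (u @ [b, a] @ v))" for u a b v
  proof -
    let ?r = "\<lambda>\<kappa>. restrict (\<lambda>x. transpose (Suc (length u)) (Suc (Suc (length u))) (\<kappa> x)) (pverts G)"
    have inv: "?r (?r \<kappa>) = \<kappa>" if "\<kappa> \<in> colorings (parcs G) (pverts G) c" for \<kappa> c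
    proof
      show "?r (?r \<kappa>) x = \<kappa> x" for x
        using PiE_arb[OF coloringsD(1)[OF that], of x] by (cases "x \<in> pverts G") auto
    qed
    have "bij_betw ?r (colorings (parcs G) (pverts G) (u @ [a, b] @ v)) (colorings (parcs G) (pverts G) (u @ [b, a] @ v))"
      by (rule bij_betw_byWitness[where f' = ?r]) (use inv recolor_mem[OF V] in blast)+
    then show ?thesis unfolding chromatic_sym_list_monomial[OF G] by (simp add: bij_betw_same_card)
  qed
  show "sum_list b = card (pverts G)" if nz: "chromatic_sym G (list_monomial b) \<noteq> 0" for b
  proof -
    have "colorings (parcs G) (pverts G) b \<noteq> {}" using nz by (auto simp: chromatic_sym_list_monomial[OF G])
    then show ?thesis using colorings_card[OF V] by fastforce
  qed
qed

lemma schur_coeff_column_chromatic_pos: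
  assumes G: "pair_graph G"
  shows "0 < schur_coeff (replicate (card (pverts G)) 1) (chromatic_sym G)"
proof -
  interpret pair_graph G by fact
  have V: "finite (pverts G)" by simp
  have sym: "sym (parcs G)" using pair_sym_arcs by (simp add: symmetric_def)
  have irrefl: "irrefl (parcs G)" using pair_no_loops by (fastforce simp: irrefl_def)
  have span: "chromatic_sym G \<in> ps.span schur_basis"
    using symmetric_in_span_schur symmetric_of_degree_chromatic[OF G] by blast
  have "schur_coeff (replicate (card (pverts G)) 1) (chromatic_sym G) =
      of_nat (card (orientations (parcs G) (pverts G)))"
    unfolding schur_coeff_column[OF span] chromatic_sym_list_monomial[OF G] alternating_sum_colorings[OF V sym]
    \<comment> \<open>The sign of \<open>schur_coeff_column\<close> and the sign of Stanley's
      theorem cancel.\<close>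
    by (simp flip: mult.assoc power_mult_distrib)
  also have "\<dots> > 0"
    using orientations_nonempty[OF V irrefl sym] finite_orientations[OF V] by (simp add: card_gt_0_iff)
  finally show ?thesis .
qed

section \<open>Independent sets and first parts of exponents\<close>

lemma finite_independent_sets:
  assumes "pair_graph G"
  shows "finite {S. independent_set G S}"
proof -
  interpret pair_graph G by fact
  show ?thesis by (rule finite_subset[of _ "Pow (pverts G)"]) (auto simp: independent_set_def)
qed

text \<open>The vertices of color 1 form an independent set whose size is the first entry of
  \<open>b\<close>; \<open>take 1\<close> also covers the empty list.\<close>

lemma chromatic_nonzero_imp_le_independence_number:
  assumes G: "pair_graph G" and nz: "chromatic_sym G (list_monomial b) \<noteq> 0"
  shows "sum_list (take 1 b) \<le> independence_number G"
proof -
  interpret pair_graph G by fact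
  have V: "finite (pverts G)" by simp
  have "colorings (parcs G) (pverts G) b \<noteq> {}"
    using nz by (auto simp: chromatic_sym_list_monomial[OF G])
  then obtain \<kappa> where \<kappa>: "\<kappa> \<in> colorings (parcs G) (pverts G) b" by blast
  let ?S = "{v \<in> pverts G. \<kappa> v \<le> 1}"
  have one: "\<kappa> v = 1" if "v \<in> ?S" for v
    using that coloringsD(1)[OF \<kappa>] by (fastforce simp: PiE_iff)
  have "independent_set G ?S"
    unfolding independent_set_def using one coloringsD(2)[OF \<kappa>] by (metis (no_types, lifting) mem_Collect_eq subsetI)
  then have "card ?S \<le> independence_number G"
    unfolding independence_number_def using finite_independent_sets[OF G] by (intro Max_ge) auto
  then show ?thesis using colorings_card_le[OF V \<kappa>, of 1] by simp
qed

lemma exists_independent_set: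
  assumes "pair_graph G"
  shows "\<exists>S. independent_set G S \<and> card S = independence_number G"
proof -
  have "independent_set G {}" by (simp add: independent_set_def)
  then have "independence_number G \<in> card ` {S. independent_set G S}"
    unfolding independence_number_def using finite_independent_sets[OF assms] by (intro Max_in) auto
  then show ?thesis by auto
qed

text \<open>Give color 1 to a maximum independent set and every other vertex a color of its
  own.\<close>

lemma chromatic_sym_hook_nonzero:
  assumes G: "pair_graph G"
  shows "chromatic_sym G (list_monomial
    (independence_number G # replicate (card (pverts G) - independence_number G) 1)) \<noteq> 0"
proof -
  interpret pair_graph G by fact
  have V: "finite (pverts G)" by simp
  obtain S where S: "independent_set G S" "card S = independence_number G"
    using exists_independent_set[OF G] by blast
  have SV: "S \<subseteq> pverts G" using S(1) by (simp add: independent_set_def)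
  then have finS: "finite S" using V finite_subset by blast
  let ?W = "pverts G - S"
  have cardW: "card ?W = card (pverts G) - independence_number G"
    using SV finS S(2) by (simp add: card_Diff_subset)
  obtain h where h: "bij_betw h ?W {0..<card ?W}"
    using ex_bij_betw_finite_nat[of ?W] V by auto
  \<comment> \<open>\<open>h\<close> counts from 0 and color 1 is taken, so the remaining colors
    start at 2.\<close>
  define \<kappa> where "\<kappa> = restrict (\<lambda>v. if v \<in> S then 1 else Suc (Suc (h v))) (pverts G)"
  have "\<kappa> \<in> colorings (parcs G) (pverts G) (card S # replicate (card ?W) 1)"
    unfolding colorings_def monomial_of_eq_list_monomial_iff[OF V]
  proof (intro CollectI conjI ballI impI allI)
    show "\<kappa> \<in> pverts G \<rightarrow>\<^sub>E {1..}" by (auto simp: \<kappa>_def)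
    show "\<kappa> u \<noteq> \<kappa> v" if "u \<in> pverts G" "v \<in> pverts G" "(u, v) \<in> parcs G" for u v
    proof -
      have "u \<noteq> v" using pair_no_loops[OF that(3)] by simp
      moreover have "\<not> (u \<in> S \<and> v \<in> S)" using S(1) that(3) by (auto simp: independent_set_def)
      ultimately show ?thesis
        using that bij_betw_imp_inj_on[OF h] by (auto simp: \<kappa>_def inj_on_def)
    qed
    fix k
    show "card {v \<in> pverts G. \<kappa> v \<le> k} = sum_list (take k (card S # replicate (card ?W) 1))"
    proof (cases k)
      case 0
      then have "{v \<in> pverts G. \<kappa> v \<le> k} = {}" by (auto simp: \<kappa>_def)
      then show ?thesis using 0 by (simp only: card.empty) simp
    next
      case (Suc j)
      \<comment> \<open>With \<open>k = Suc j\<close>, the color \<open>h v + 2\<close> is at most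
        \<open>k\<close> exactly when \<open>h v < j\<close>.\<close>
      have "{v \<in> pverts G. \<kappa> v \<le> k} = S \<union> {v \<in> ?W. h v < j}"
        using SV by (auto simp: \<kappa>_def Suc)
      then have "card {v \<in> pverts G. \<kappa> v \<le> k} = card S + card {v \<in> ?W. h v < j}"
        using finS V by (simp add: card_Un_disjoint disjoint_iff)
      also have "card {v \<in> ?W. h v < j} = card (h ` {v \<in> ?W. h v < j})"
        using bij_betw_imp_inj_on[OF h] by (intro card_image[symmetric]) (auto simp: inj_on_def)
      also have "h ` {v \<in> ?W. h v < j} = {0..<card ?W} \<inter> {..<j}"
        using bij_betw_imp_surj_on[OF h] by auto
      also have "card \<dots> = min j (card ?W)"
      proof -
        have "{0..<card ?W} \<inter> {..<j} = {..<min j (card ?W)}" by auto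
        then show ?thesis by simp
      qed
      finally show ?thesis by (simp add: Suc sum_list_replicate)
    qed
  qed
  then show ?thesis
    using finite_colorings[OF V, of "parcs G"] by (auto simp: chromatic_sym_list_monomial[OF G] S(2) cardW card_eq_0_iff)
qed

theorem proposition4p1:
  fixes G :: "'a pair_pre_digraph" and H :: "'b pair_pre_digraph" and n :: nat
  assumes "pair_graph G" and "pair_graph H"
    and "Digraph_Component.connected (with_proj G)"
    and "Digraph_Component.connected (with_proj H)"
    and "card (pverts G) = n" and "card (pverts H) = n"
    and "G \<ge>\<^sub>s H"
  shows "independence_number G \<ge> independence_number H"
proof (rule ccontr)
  assume "\<not> independence_number G \<ge> independence_number H"
  then have less: "independence_number G < independence_number H" by simp
  note G = assms(1) and H = assms(2)
  let ?X = "chromatic_sym G" and ?Y = "chromatic_sym H" and ?a = "independence_number H"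
  define c where "c = schur_coeff (replicate n 1) ?X / schur_coeff (replicate n 1) ?Y"
  have "0 < c"
    using schur_coeff_column_chromatic_pos[OF G] schur_coeff_column_chromatic_pos[OF H] assms(5,6)
    by (simp add: c_def)
  have diff: "schur_diff G H = ?X + ps_scale (- c) ?Y"
    by (simp add: schur_diff_def c_def assms(5) fun_eq_iff ps_scale_def)
  have symX: "symmetric_of_degree n ?X" and symY: "symmetric_of_degree n ?Y"
    using symmetric_of_degree_chromatic[OF G] symmetric_of_degree_chromatic[OF H] assms(5,6) by simp_all
  then have span: "schur_diff G H \<in> ps.span schur_basis"
    unfolding diff by (intro symmetric_in_span_schur symmetric_of_degree_add symmetric_of_degree_scale)
  let ?P = "{l \<in> partitions n. ?Y (list_monomial l) \<noteq> 0 \<and> sum_list (take 1 l) = ?a}"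
  let ?hook = "?a # replicate (n - ?a) 1"
  \<comment> \<open>The hook witnesses that \<open>?P\<close> is nonempty, so a member of largest
    rank exists.\<close>
  have "?hook \<in> ?P"
  proof -
    have "?Y (list_monomial ?hook) \<noteq> 0" using chromatic_sym_hook_nonzero[OF H] assms(6) by simp
    moreover from this have "sum_list ?hook = n" using symY unfolding symmetric_of_degree_def by blast
    \<comment> \<open>The first part is positive because \<open>less\<close> puts \<open>?a\<close>
      strictly above another natural number.\<close>
    moreover have "is_partition ?hook"
      using less by (auto simp: is_partition_def sorted_wrt_iff_nth_less nth_Cons' )
    ultimately show ?thesis by (simp add: partitions_def)
  qed
  moreover have fin: "finite ?P" using finite_partitions by simp
  ultimately have "Max (dominance_rank ` ?P) \<in> dominance_rank ` ?P" by (intro Max_in) auto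
  then obtain l where l: "l \<in> ?P" and "Max (dominance_rank ` ?P) = dominance_rank l" by blast
  then have max: "dominance_rank m \<le> dominance_rank l" if "m \<in> ?P" for m
    using Max_ge[of "dominance_rank ` ?P" "dominance_rank m"] fin that by auto
  have part: "is_partition l" using l by (simp add: partitions_def)
  \<comment> \<open>A list dominating \<open>l\<close> has first entry at least \<open>?a\<close>,
    too large for a color class of \<open>G\<close>; the case \<open>m = l\<close> is
    included.\<close>
  have X0: "?X (list_monomial m) = 0" if "dominates m l" for m
  proof (rule ccontr)
    assume "?X (list_monomial m) \<noteq> 0"
    then have "sum_list (take 1 m) \<le> independence_number G"
      using chromatic_nonzero_imp_le_independence_number[OF G] by blast
    moreover have "sum_list (take 1 l) \<le> sum_list (take 1 m)" using that by (simp only: dominates_def)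
    ultimately show False using l less by simp
  qed
  \<comment> \<open>The first part of such an \<open>m\<close> is at least that of \<open>l\<close>
    and at most \<open>?a\<close>, hence equal to \<open>?a\<close>, so \<open>m\<close> would be a
    member of \<open>?P\<close> of larger rank than \<open>l\<close>.\<close>
  have Y0: "?Y (list_monomial m) = 0" if m: "is_partition m" "dominates m l" "m \<noteq> l" for m
  proof (rule ccontr)
    assume nz: "?Y (list_monomial m) \<noteq> 0"
    then have "sum_list (take 1 m) \<le> ?a"
      using chromatic_nonzero_imp_le_independence_number[OF H] by blast
    moreover have "sum_list (take 1 l) \<le> sum_list (take 1 m)" "sum_list m = sum_list l"
      using m(2) by (simp_all only: dominates_def)
    ultimately have "m \<in> ?P" using m(1) nz l by (auto simp: partitions_def)
    then show False using max[of m] dominance_rank_less[OF m(1) part m(2,3)] by simp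
  qed
  have "schur_coeff l (schur_diff G H) = schur_diff G H (list_monomial l)"
    by (rule schur_coeff_top[OF span part]) (simp add: diff ps_scale_def X0 Y0)
  also have "\<dots> = - (c * ?Y (list_monomial l))"
    using X0[of l] by (simp add: diff ps_scale_def dominates_def)
  also have "\<dots> < 0"
  proof -
    have "0 \<le> ?Y (list_monomial l)" by (simp add: chromatic_sym_def)
    then show ?thesis using l \<open>0 < c\<close> by simp
  qed
  finally show False using assms(7) part by (force simp: schur_ge_def schur_positive_def)
qed

end
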